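(* Let $n \geq 3$, let $\mathcal{H} = \mathbb{C}^n$, and suppose that $U$ and $V$ are unitary operators on $\mathcal{H}$ such that the minimal polynomial of $U$ is a quadratic polynomial (degree $2$) and the minimal polynomial of $V$ is a cubic polynomial (degree $3$). Then there exist $U_0 \in \mathcal{U}(U)$ and $V_0 \in \mathcal{U}(V)$ such that the algebra generated by $U_0$ and $V_0$ is all of $\mathcal{B}(\mathcal{H})$ if and only if $$q_1 + p_1 \leq n,$$ where $q_1$ is the larger of the multiplicities of the eigenvalues of $U$, and $p_1$ is the largest of the multiplicities of the eigenvalues of $V$.
   Context: $\mathcal{B}(\mathcal{H})$ is the algebra of all (bounded) linear operators on $\mathcal{H}$. For $T \in \mathcal{B}(\mathcal{H})$, the unitary orbit of $T$ is $\mathcal{U}(T) := \{W^* T W : W \in \mathcal{B}(\mathcal{H}) \text{ unitary}\}$. The multiplicity of an eigenvalue is the dimension of its eigenspace. *)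

theory Defs
  imports "Jordan_Normal_Form.Spectral_Radius" "Jordan_Normal_Form.Matrix_Kernel"
begin

text \<open>
  Operators on \<open>\<complex>\<^sup>n\<close> are represented by their matrices in the standard orthonormal basis, so
  the algebra of all operators is \<^term>\<open>carrier_mat n n :: complex mat set\<close>, and
  \<^const>\<open>mat_adjoint\<close> (the conjugate transpose) is the Hilbert space adjoint.
\<close>

definition unitary_mat :: "nat \<Rightarrow> complex mat \<Rightarrow> bool" where
  "unitary_mat n W \<longleftrightarrow> W \<in> carrier_mat n n \<and>
     mat_adjoint W * W = 1\<^sub>m n \<and> W * mat_adjoint W = 1\<^sub>m n"

definition unitary_orbit :: "nat \<Rightarrow> complex mat \<Rightarrow> complex mat set" where
  "unitary_orbit n T = {mat_adjoint W * T * W | W. unitary_mat n W}"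

text \<open>The value \<open>p(A) = \<Sum>\<^sub>k (coeff p k) A\<^sup>k\<close> for an \<open>n \<times> n\<close> matrix \<open>A\<close>, written entrywise.\<close>

definition poly_mat :: "nat \<Rightarrow> complex poly \<Rightarrow> complex mat \<Rightarrow> complex mat" where
  "poly_mat n p A = mat n n (\<lambda>(i, j). \<Sum>k\<le>degree p. coeff p k * (A ^\<^sub>m k) $$ (i, j))"

definition is_minimal_poly :: "nat \<Rightarrow> complex mat \<Rightarrow> complex poly \<Rightarrow> bool" where
  "is_minimal_poly n A p \<longleftrightarrow> monic p \<and> poly_mat n p A = 0\<^sub>m n n \<and>
     (\<forall>q. q \<noteq> 0 \<and> poly_mat n q A = 0\<^sub>m n n \<longrightarrow> degree p \<le> degree q)"

definition is_subalgebra :: "nat \<Rightarrow> complex mat set \<Rightarrow> bool" where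
  "is_subalgebra n S \<longleftrightarrow> S \<subseteq> carrier_mat n n \<and> 1\<^sub>m n \<in> S \<and>
     (\<forall>A\<in>S. \<forall>B\<in>S. A + B \<in> S) \<and>
     (\<forall>c. \<forall>A\<in>S. c \<cdot>\<^sub>m A \<in> S) \<and>
     (\<forall>A\<in>S. \<forall>B\<in>S. A * B \<in> S)"

text \<open>
  Subalgebras are required to be unital. For generating sets that contain an invertible matrix
  \<open>A\<close> this makes no difference: the identity is a polynomial in \<open>A\<close> without constant term.
\<close>

definition generated_algebra :: "nat \<Rightarrow> complex mat set \<Rightarrow> complex mat set" where
  "generated_algebra n X = is_subalgebra n hull X"

text \<open>
  The geometric multiplicity: \<^term>\<open>char_matrix A a\<close> is \<open>A - a I\<close>, whose kernel is the eigenspace.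
\<close>

definition eigen_mult :: "complex mat \<Rightarrow> complex \<Rightarrow> nat" where
  "eigen_mult A a = kernel_dim (char_matrix A a)"

lemma mat_kernel_char_matrix:
  assumes "A \<in> carrier_mat n n"
  shows "mat_kernel (char_matrix A a) = {v \<in> carrier_vec n. A *\<^sub>v v = a \<cdot>\<^sub>v v}"
proof -
  have A: "dim_row A = n" "dim_col A = n" using assms by auto
  have e: "char_matrix A a *\<^sub>v v = A *\<^sub>v v - a \<cdot>\<^sub>v v" if v: "v \<in> carrier_vec n" for v
    unfolding char_matrix_def
    by (subst add_mult_distrib_mat_vec[OF assms _ v]) (use assms v in auto)
  have "A *\<^sub>v v - a \<cdot>\<^sub>v v = 0\<^sub>v n \<longleftrightarrow> A *\<^sub>v v = a \<cdot>\<^sub>v v" if v: "v \<in> carrier_vec n" for v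
  proof -
    have d: "dim_vec (A *\<^sub>v v) = n" "dim_vec (a \<cdot>\<^sub>v v) = n" using A v by auto
    show ?thesis by (auto simp: vec_eq_iff A carrier_vecD[OF v])
  qed
  then show ?thesis
    using assms e by (auto simp: mat_kernel_def char_matrix_def)
qed

definition max_mult :: "complex mat \<Rightarrow> nat" where
  "max_mult A = Max (eigen_mult A ` spectrum A)"

end

theory Submission
  imports Defs "HOL-Combinatorics.Permutations" "Jordan_Normal_Form.Jordan_Normal_Form_Uniqueness"
begin

text \<open>
  If \<open>q\<^sub>1 + p\<^sub>1 > n\<close>, an eigenspace of \<open>U\<^sub>0\<close> meets an eigenspace of \<open>V\<^sub>0\<close>, and a common
  eigenvector is an eigenvector of the whole algebra.

  Conversely let \<open>r = n - q\<^sub>1\<close>, so that \<open>p\<^sub>b \<le> r\<close> for all three multiplicities of \<open>V\<close> and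
  \<open>2 r \<le> n\<close>. Take \<open>V\<^sub>0\<close> diagonal, with blocks of sizes \<open>p\<^sub>1, p\<^sub>2, p\<^sub>3\<close>, and let the eigenspace of
  \<open>U\<^sub>0\<close> of dimension \<open>r\<close> be the range of a real isometry \<open>T\<close> on \<open>\<complex>\<^sup>r\<close>, whose three blocks are
  (up to zero rows) \<open>\<tau>\<close>, \<open>\<gamma>\<^sub>1 F \<kappa>\<close> and \<open>\<gamma>\<^sub>2 F \<kappa>\<close>. Here \<open>\<tau>, \<kappa>, \<gamma>\<^sub>1, \<gamma>\<^sub>2\<close> are diagonal with
  \<open>\<tau>\<^sup>2 + \<kappa>\<^sup>2 = \<gamma>\<^sub>1\<^sup>2 + \<gamma>\<^sub>2\<^sup>2 = 1\<close>, and \<open>F = 1 - 2 w w\<^sup>T\<close> is a reflection. The compression of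
  \<open>p = T T\<^sup>T\<close> to the first block is \<open>\<tau>\<^sup>2\<close>; as this has distinct entries, the algebra contains
  the diagonal matrix units of the first block. The off-diagonal entries of \<open>F \<gamma>\<^sub>1\<^sup>2 F\<close>, if nonzero,
  link these units to each other, and from the first block all coordinate vectors of the other
  two are reached. The ranks are matched by choosing how often
  \<open>\<gamma>\<^sub>1\<^sup>2\<close> takes the values 0 and 1, and a generic \<open>w\<close> makes the off-diagonal entries nonzero.
\<close>

section \<open>Diagonalization of unitary matrices\<close>

lemma mat_adjoint_dim [simp]:
  "dim_row (mat_adjoint A) = dim_col A" "dim_col (mat_adjoint A) = dim_row A"
  by (simp_all add: mat_adjoint_def)

lemma mat_adjoint_carrier [simp]: "A \<in> carrier_mat n m \<Longrightarrow> mat_adjoint A \<in> carrier_mat m n"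
  unfolding carrier_mat_def by simp

lemma index_mat_adjoint [simp]:
  "i < dim_col A \<Longrightarrow> j < dim_row A \<Longrightarrow> mat_adjoint A $$ (i, j) = conjugate (A $$ (j, i))"
  by (simp add: mat_adjoint_def mat_of_rows_index)

lemma mat_adjoint_adjoint [simp]:
  fixes A :: "complex mat" shows "mat_adjoint (mat_adjoint A) = A"
  by (rule eq_matI) auto

lemma index_mult:
  assumes "A \<in> carrier_mat n m" "B \<in> carrier_mat m k" "i < n" "j < k"
  shows "(A * B) $$ (i, j) = (\<Sum>l<m. A $$ (i, l) * B $$ (l, j))"
  using assms by (simp add: scalar_prod_def atLeast0LessThan)

lemma index_mult_vec:
  assumes "A \<in> carrier_mat n m" "x \<in> carrier_vec m" "i < n"
  shows "(A *\<^sub>v x) $ i = (\<Sum>l<m. A $$ (i, l) * x $ l)"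
  using assms by (simp add: scalar_prod_def atLeast0LessThan)

lemma mat_adjoint_mult:
  fixes A B :: "complex mat"
  assumes "A \<in> carrier_mat n m" "B \<in> carrier_mat m k"
  shows "mat_adjoint (A * B) = mat_adjoint B * mat_adjoint A"
proof (rule eq_matI)
  fix i j assume "i < dim_row (mat_adjoint B * mat_adjoint A)" "j < dim_col (mat_adjoint B * mat_adjoint A)"
  then have ij: "i < k" "j < n" using assms by auto
  have "mat_adjoint (A * B) $$ (i, j) = cnj ((A * B) $$ (j, i))"
    using assms ij by (subst index_mat_adjoint) auto
  also have "\<dots> = (\<Sum>l<m. mat_adjoint B $$ (i, l) * mat_adjoint A $$ (l, j))"
    using assms ij by (simp add: index_mult[OF assms] mult.commute del: index_mult_mat)
  also have "\<dots> = (mat_adjoint B * mat_adjoint A) $$ (i, j)"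
    using assms ij by (intro index_mult[symmetric]) auto
  finally show "mat_adjoint (A * B) $$ (i, j) = (mat_adjoint B * mat_adjoint A) $$ (i, j)" .
qed (use assms in auto)

lemma unitary_matI:
  assumes "W \<in> carrier_mat n n" "mat_adjoint W * W = 1\<^sub>m n"
  shows "unitary_mat n W"
  using assms mat_mult_left_right_inverse[OF _ assms(1) assms(2)]
  by (auto simp: unitary_mat_def)

lemma unitary_matD:
  assumes "unitary_mat n W"
  shows "W \<in> carrier_mat n n" "mat_adjoint W \<in> carrier_mat n n"
    "mat_adjoint W * W = 1\<^sub>m n" "W * mat_adjoint W = 1\<^sub>m n"
  using assms by (auto simp: unitary_mat_def)

lemma unitary_mat_adjoint: "unitary_mat n W \<Longrightarrow> unitary_mat n (mat_adjoint W)"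
  by (simp add: unitary_mat_def)

lemma unitary_mat_mult:
  assumes "unitary_mat n W" "unitary_mat n X" shows "unitary_mat n (W * X)"
proof (rule unitary_matI)
  note [simp] = unitary_matD[OF assms(1)] unitary_matD[OF assms(2)]
  show WX: "W * X \<in> carrier_mat n n" by (rule mult_carrier_mat[of _ n n]) simp_all
  have "mat_adjoint (W * X) * (W * X) = mat_adjoint X * mat_adjoint W * (W * X)"
    by (simp add: mat_adjoint_mult[of _ n n _ n])
  also have "\<dots> = mat_adjoint X * (mat_adjoint W * (W * X))"
    by (rule assoc_mult_mat[of _ n n _ n _ n]) (simp_all add: WX)
  also have "mat_adjoint W * (W * X) = mat_adjoint W * W * X"
    by (rule assoc_mult_mat[symmetric, of _ n n _ n _ n]) simp_all
  also have "\<dots> = X" by (simp add: left_mult_one_mat[of _ n n])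
  finally show "mat_adjoint (W * X) * (W * X) = 1\<^sub>m n" by simp
qed

text \<open>Fewer than \<open>n\<close> homogeneous equations in \<open>n\<close> unknowns, padded
  with zero rows, form a singular square matrix. This serves both to leave room in an orthogonal
  complement and to intersect two eigenspaces.\<close>

lemma exists_common_zero:
  fixes w :: "'j \<Rightarrow> nat \<Rightarrow> complex"
  assumes "finite J" "card J < n"
  shows "\<exists>x\<in>carrier_vec n. x \<noteq> 0\<^sub>v n \<and> (\<forall>j\<in>J. (\<Sum>l<n. w j l * x $ l) = 0)"
proof -
  obtain h where h: "bij_betw h {..<card J} J"
    using ex_bij_betw_nat_finite[OF assms(1)] by (auto simp: atLeast0LessThan)
  define M where "M = mat n n (\<lambda>(i, l). if i < card J then w (h i) l else 0)"
  have M: "M \<in> carrier_mat n n" by (simp add: M_def)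
  \<comment> \<open>Row \<open>card J\<close> is one of the padding rows; displaying it as zero lets
    \<open>det_row_0\<close> apply.\<close>
  have "M = mat\<^sub>r n n (\<lambda>i. if i = card J then 0\<^sub>v n else row M i)"
    using assms(2) by (intro eq_matI) (auto simp: M_def)
  also have "det \<dots> = 0" using assms(2) M by (intro det_row_0) auto
  finally obtain x where x: "x \<in> carrier_vec n" "x \<noteq> 0\<^sub>v n" "M *\<^sub>v x = 0\<^sub>v n"
    using det_0_iff_vec_prod_zero[OF M] by auto
  have "(\<Sum>l<n. w j l * x $ l) = 0" if "j \<in> J" for j
  proof -
    have "j \<in> h ` {..<card J}" using h that by (simp add: bij_betw_def)
    then obtain i where i: "i < card J" "h i = j" by auto
    then have "i < n" using assms by simp
    then have "(\<Sum>l<n. w j l * x $ l) = (M *\<^sub>v x) $ i"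
      unfolding index_mult_vec[OF M x(1) \<open>i < n\<close>] using i by (simp add: M_def)
    then show ?thesis using x(3) \<open>i < n\<close> by simp
  qed
  then show ?thesis using x by blast
qed

section \<open>Orthonormal eigenbases of unitary matrices\<close>

definition inner :: "nat \<Rightarrow> complex vec \<Rightarrow> complex vec \<Rightarrow> complex" where
  "inner n x y = (\<Sum>l<n. x $ l * cnj (y $ l))"

lemma inner_adjoint:
  assumes A: "A \<in> carrier_mat n n" and x: "x \<in> carrier_vec n" and y: "y \<in> carrier_vec n"
  shows "inner n (A *\<^sub>v x) y = inner n x (mat_adjoint A *\<^sub>v y)"
proof -
  have "inner n (A *\<^sub>v x) y = (\<Sum>i<n. \<Sum>l<n. A $$ (i, l) * x $ l * cnj (y $ i))"
    by (simp add: inner_def index_mult_vec[OF A x] sum_distrib_right del: index_mult_mat_vec)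
  also have "\<dots> = (\<Sum>l<n. \<Sum>i<n. A $$ (i, l) * x $ l * cnj (y $ i))"
    by (rule sum.swap)
  also have "\<dots> = inner n x (mat_adjoint A *\<^sub>v y)"
    using A by (simp add: inner_def index_mult_vec[OF mat_adjoint_carrier[OF A] y] sum_distrib_left
        mult_ac del: index_mult_mat_vec)
  finally show ?thesis .
qed

lemma inner_unitary:
  assumes "unitary_mat n A" "x \<in> carrier_vec n" "y \<in> carrier_vec n"
  shows "inner n (A *\<^sub>v x) (A *\<^sub>v y) = inner n x y"
proof -
  have "mat_adjoint A *\<^sub>v (A *\<^sub>v y) = y"
    using assms unitary_matD[OF assms(1)]
    by (subst assoc_mult_mat_vec[symmetric, of _ n n _ n]) auto
  then show ?thesis
    using assms unitary_matD[OF assms(1)] by (subst inner_adjoint) auto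
qed

lemma inner_self: "inner n x x = of_real (\<Sum>l<n. (cmod (x $ l))\<^sup>2)"
  unfolding inner_def of_real_sum complex_norm_square ..

text \<open>With \<open>y k\<close> a coordinate of \<open>A^k x\<close>, splitting off the factor
  with root \<open>z\<close> amounts to replacing \<open>x\<close> by \<open>A x - z x\<close>. This
  drives the degree induction of the next lemma.\<close>

lemma poly_functional_step:
  fixes y :: "nat \<Rightarrow> complex"
  assumes "q \<noteq> 0"
  shows "(\<Sum>k\<le>degree ([:-z, 1:] * q). coeff ([:-z, 1:] * q) k * y k) =
    (\<Sum>k\<le>degree q. coeff q k * (y (Suc k) - z * y k))"
proof -
  have deg: "degree ([:-z, 1:] * q) = Suc (degree q)"
    using assms by (subst degree_mult_eq) auto
  have e: "[:-z, 1:] * q = pCons 0 q - Polynomial.smult z q" by simp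
  have "(\<Sum>k\<le>Suc (degree q). coeff (pCons 0 q) k * y k) = (\<Sum>k\<le>degree q. coeff q k * y (Suc k))"
    by (subst sum.atMost_Suc_shift) simp
  moreover have "(\<Sum>k\<le>Suc (degree q). z * coeff q k * y k) = (\<Sum>k\<le>degree q. z * coeff q k * y k)"
    by (simp add: coeff_eq_0)
  ultimately show ?thesis
    unfolding deg unfolding e by (simp add: algebra_simps sum_subtractf del: sum.atMost_Suc)
qed

text \<open>Induction on the degree of a polynomial annihilating \<open>x\<close>. For a root
  \<open>z\<close>, either \<open>A x - z x\<close> vanishes and \<open>x\<close> is an eigenvector,
  or it is a nonzero vector of \<open>X\<close> annihilated by the quotient.\<close>

lemma exists_eigenvector_in_invariant:
  fixes A :: "complex mat"
  assumes A: "A \<in> carrier_mat n n"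
    and X: "X \<subseteq> carrier_vec n" "\<And>x z. x \<in> X \<Longrightarrow> A *\<^sub>v x - z \<cdot>\<^sub>v x \<in> X"
    and q: "q \<noteq> 0" and x: "x \<in> X" "x \<noteq> 0\<^sub>v n"
    and ann: "\<And>i. i < n \<Longrightarrow> (\<Sum>k\<le>degree q. coeff q k * ((A ^\<^sub>m k) *\<^sub>v x) $ i) = 0"
  shows "\<exists>z y. y \<in> X \<and> y \<noteq> 0\<^sub>v n \<and> A *\<^sub>v y = z \<cdot>\<^sub>v y"
  using q x ann
proof (induction "degree q" arbitrary: q x)
  case 0
  then obtain c where c: "q = [:c:]" "c \<noteq> 0" using degree_eq_zeroE[of q] by auto
  have xc: "x \<in> carrier_vec n" using 0 X by auto
  have "x $ i = 0" if "i < n" for i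
    using 0(5)[OF that] c xc A by simp
  then have "x = 0\<^sub>v n" using xc by (intro eq_vecI) auto
  then show ?case using 0 by simp
next
  case (Suc m)
  have "\<not> constant (poly q)" using Suc(2) by (simp add: constant_degree)
  then obtain z where "poly q z = 0" using fundamental_theorem_of_algebra by blast
  then obtain q' where q': "q = [:-z, 1:] * q'" using poly_eq_0_iff_dvd by blast
  then have q'0: "q' \<noteq> 0" using Suc by auto
  have deg: "m = degree q'" using Suc(2) unfolding q' by (subst (asm) degree_mult_eq) (use q'0 in auto)
  have xc: "x \<in> carrier_vec n" using Suc X by auto
  let ?x = "A *\<^sub>v x - z \<cdot>\<^sub>v x"
  have Ax: "A *\<^sub>v x \<in> carrier_vec n" using A xc by auto
  show ?case
  proof (cases "?x = 0\<^sub>v n")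
    case True
    have "A *\<^sub>v x = z \<cdot>\<^sub>v x"
    proof (rule eq_vecI)
      fix i assume "i < dim_vec (z \<cdot>\<^sub>v x)"
      then have i: "i < n" using xc by simp
      then have "?x $ i = 0" using True by simp
      then show "(A *\<^sub>v x) $ i = (z \<cdot>\<^sub>v x) $ i" using i xc A by simp
    qed (use xc A in auto)
    then show ?thesis using Suc by blast
  next
    case False
    show ?thesis
    proof (rule Suc(1)[OF deg q'0 _ False])
      show "?x \<in> X" using Suc X by blast
      fix i assume i: "i < n"
      have "((A ^\<^sub>m k) *\<^sub>v ?x) $ i = ((A ^\<^sub>m Suc k) *\<^sub>v x) $ i - z * ((A ^\<^sub>m k) *\<^sub>v x) $ i" for k
      proof -
        have Ak: "A ^\<^sub>m k \<in> carrier_mat n n" using A by simp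
        have "(A ^\<^sub>m k) *\<^sub>v ?x = (A ^\<^sub>m k) *\<^sub>v (A *\<^sub>v x) - (A ^\<^sub>m k) *\<^sub>v (z \<cdot>\<^sub>v x)"
          using Ak Ax xc by (subst mult_minus_distrib_mat_vec[OF Ak]) auto
        also have "(A ^\<^sub>m k) *\<^sub>v (A *\<^sub>v x) = (A ^\<^sub>m Suc k) *\<^sub>v x"
          using A Ak xc by (simp add: assoc_mult_mat_vec[of _ n n _ n])
        also have "(A ^\<^sub>m k) *\<^sub>v (z \<cdot>\<^sub>v x) = z \<cdot>\<^sub>v ((A ^\<^sub>m k) *\<^sub>v x)"
          using Ak xc by (rule mult_mat_vec)
        finally show ?thesis using i Ak A xc by (simp del: index_mult_mat_vec pow_mat.simps)
      qed
      then have "(\<Sum>k\<le>degree q'. coeff q' k * ((A ^\<^sub>m k) *\<^sub>v ?x) $ i) =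
        (\<Sum>k\<le>degree q. coeff q k * ((A ^\<^sub>m k) *\<^sub>v x) $ i)"
        unfolding q' poly_functional_step[OF q'0] by simp
      then show "(\<Sum>k\<le>degree q'. coeff q' k * ((A ^\<^sub>m k) *\<^sub>v ?x) $ i) = 0"
        using Suc(6)[OF i] by simp
    qed
  qed
qed

text \<open>The orthogonal complement of eigenvectors of a unitary matrix is invariant, and it is
  nonzero for fewer than \<open>n\<close> vectors, so it contains a further eigenvector.\<close>

lemma exists_orthonormal_eigenvectors:
  assumes A: "unitary_mat n A" and q: "q \<noteq> 0" "poly_mat n q A = 0\<^sub>m n n"
  shows "k \<le> n \<Longrightarrow> \<exists>v d. (\<forall>i<k. v i \<in> carrier_vec n \<and> A *\<^sub>v v i = d i \<cdot>\<^sub>v v i) \<and>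
    (\<forall>i<k. \<forall>j<k. inner n (v i) (v j) = (if i = j then 1 else 0))"
proof (induction k)
  case (Suc k)
  then obtain v d where vd: "\<forall>i<k. v i \<in> carrier_vec n \<and> A *\<^sub>v v i = d i \<cdot>\<^sub>v v i"
    "\<forall>i<k. \<forall>j<k. inner n (v i) (v j) = (if i = j then 1 else 0)"
    using Suc_leD by blast
  have v: "\<And>i. i < k \<Longrightarrow> v i \<in> carrier_vec n"
    "\<And>i. i < k \<Longrightarrow> A *\<^sub>v v i = d i \<cdot>\<^sub>v v i"
    "\<And>i j. i < k \<Longrightarrow> j < k \<Longrightarrow> inner n (v i) (v j) = (if i = j then 1 else 0)"
    using vd by auto
  note Ac = unitary_matD(1)[OF A]
  define X where "X = {x \<in> carrier_vec n. \<forall>i<k. inner n x (v i) = 0}"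
  obtain x where x: "x \<in> X" "x \<noteq> 0\<^sub>v n"
    using exists_common_zero[of "{..<k}" n "\<lambda>i l. cnj (v i $ l)"] Suc
    by (auto simp: X_def inner_def mult.commute)
  have XA: "A *\<^sub>v x - z \<cdot>\<^sub>v x \<in> X" if "x \<in> X" for x z
  proof -
    have xc: "x \<in> carrier_vec n" using that by (simp add: X_def)
    have Axc: "A *\<^sub>v x \<in> carrier_vec n" using Ac xc by auto
    have "inner n (A *\<^sub>v x - z \<cdot>\<^sub>v x) (v i) = 0" if i: "i < k" for i
    proof -
      have s: "inner n y (d i \<cdot>\<^sub>v v i) = cnj (d i) * inner n y (v i)" for y
        using v(1)[OF i] by (simp add: inner_def sum_distrib_left mult_ac)
      \<comment> \<open>Pairing \<open>A x\<close> with \<open>A (v i)\<close> gives the pairing of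
        \<open>x\<close> with \<open>v i\<close>, which is 0, and \<open>A (v i)\<close> is
        \<open>d i\<close> times \<open>v i\<close>. Unitarity also excludes
        \<open>d i = 0\<close>.\<close>
      have "cnj (d i) * inner n (A *\<^sub>v x) (v i) = 0"
        using inner_unitary[OF A xc v(1)[OF i]] \<open>x \<in> X\<close> i by (simp add: v(2) s X_def)
      moreover have "d i \<noteq> 0"
        using inner_unitary[OF A v(1)[OF i] v(1)[OF i]] i by (auto simp: v(2,3) s)
      ultimately have "inner n (A *\<^sub>v x) (v i) = 0" by simp
      moreover have "inner n (A *\<^sub>v x - z \<cdot>\<^sub>v x) (v i) = inner n (A *\<^sub>v x) (v i) - z * inner n x (v i)"
        using xc Axc by (simp add: inner_def sum_subtractf sum_distrib_left algebra_simps del: index_mult_mat_vec)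
      ultimately show ?thesis using \<open>x \<in> X\<close> i by (simp add: X_def)
    qed
    then show ?thesis using xc Axc by (simp add: X_def)
  qed
  have "\<exists>z y. y \<in> X \<and> y \<noteq> 0\<^sub>v n \<and> A *\<^sub>v y = z \<cdot>\<^sub>v y"
  proof (rule exists_eigenvector_in_invariant[OF Ac _ XA q(1) x])
    show "X \<subseteq> carrier_vec n" by (auto simp: X_def)
    fix i assume i: "i < n"
    have xc: "x \<in> carrier_vec n" using x by (simp add: X_def)
    have "(\<Sum>k\<le>degree q. coeff q k * ((A ^\<^sub>m k) *\<^sub>v x) $ i) =
        (\<Sum>k\<le>degree q. \<Sum>l<n. coeff q k * (A ^\<^sub>m k) $$ (i, l) * x $ l)"
      using i xc by (simp add: index_mult_vec[OF pow_carrier_mat[OF Ac]] sum_distrib_left mult.assoc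
          del: index_mult_mat_vec)
    also have "\<dots> = (\<Sum>l<n. poly_mat n q A $$ (i, l) * x $ l)"
      using i by (subst sum.swap) (simp add: poly_mat_def sum_distrib_right)
    also have "\<dots> = 0" using i by (simp add: q(2))
    finally show "(\<Sum>k\<le>degree q. coeff q k * ((A ^\<^sub>m k) *\<^sub>v x) $ i) = 0" .
  qed
  then obtain z y where y: "y \<in> carrier_vec n" "y \<noteq> 0\<^sub>v n" "A *\<^sub>v y = z \<cdot>\<^sub>v y"
    "\<And>i. i < k \<Longrightarrow> inner n y (v i) = 0" by (auto simp: X_def)
  define s where "s = (\<Sum>l<n. (cmod (y $ l))\<^sup>2)"
  have "\<exists>l<n. y $ l \<noteq> 0" using y(1,2) by (metis carrier_vecD eq_vecI index_zero_vec(1,2))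
  then have s: "s > 0" unfolding s_def by (auto intro!: sum_pos2)
  define c where "c = complex_of_real (1 / sqrt s)"
  have sy: "inner n (a \<cdot>\<^sub>v y) u = a * inner n y u" "inner n u (a \<cdot>\<^sub>v y) = cnj a * inner n u y" for a u
    using y(1) by (simp_all add: inner_def sum_distrib_left mult_ac)
  have "inner n y y = of_real s" by (simp add: inner_self s_def)
  then have 1: "inner n (c \<cdot>\<^sub>v y) (c \<cdot>\<^sub>v y) = 1"
    using s by (simp add: sy c_def real_sqrt_mult_self flip: of_real_mult of_real_divide) 
  have cnj: "inner n u w = cnj (inner n w u)" for u w
    by (simp add: inner_def mult.commute)
  let ?v = "v(k := c \<cdot>\<^sub>v y)" and ?d = "d(k := z)"
  have "?v i \<in> carrier_vec n \<and> A *\<^sub>v ?v i = ?d i \<cdot>\<^sub>v ?v i" if "i < Suc k" for i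
  proof (cases "i = k")
    case True
    have "A *\<^sub>v (c \<cdot>\<^sub>v y) = c \<cdot>\<^sub>v (z \<cdot>\<^sub>v y)"
      using mult_mat_vec[OF Ac y(1), of c] y(3) by simp
    then show ?thesis using True y(1) by (simp add: smult_smult_assoc mult.commute)
  qed (use v that in auto)
  moreover have "inner n (?v i) (?v j) = (if i = j then 1 else 0)" if "i < Suc k" "j < Suc k" for i j
    using that 1 v(3)[of i j] y(4)[of i] y(4)[of j] cnj[of "v i" y]
    by (auto simp: sy less_Suc_eq)
  ultimately show ?case by blast
qed simp

section \<open>Diagonalized matrices: polynomials, multiplicities, trace\<close>

text \<open>The adjoint stands on the left, as in \<open>unitary_orbit\<close>; the eigenvectors of
  \<open>A\<close> are therefore the columns of \<open>mat_adjoint W\<close>.\<close>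

definition diagonalized :: "nat \<Rightarrow> complex mat \<Rightarrow> complex mat \<Rightarrow> (nat \<Rightarrow> complex) \<Rightarrow> bool" where
  "diagonalized n A W d \<longleftrightarrow> unitary_mat n W \<and> A = mat_adjoint W * mat_diag n d * W"

lemma diagonalized_carrier: "diagonalized n A W d \<Longrightarrow> A \<in> carrier_mat n n"
  by (auto simp: diagonalized_def unitary_mat_def)

lemma unitary_diagonalizable:
  assumes A: "unitary_mat n A" and q: "q \<noteq> 0" "poly_mat n q A = 0\<^sub>m n n"
  shows "\<exists>W d. diagonalized n A W d"
proof -
  obtain v d where vd: "\<forall>i<n. v i \<in> carrier_vec n \<and> A *\<^sub>v v i = d i \<cdot>\<^sub>v v i"
    "\<forall>i<n. \<forall>j<n. inner n (v i) (v j) = (if i = j then 1 else 0)"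
    using exists_orthonormal_eigenvectors[OF assms order_refl] by blast
  have v: "\<And>i. i < n \<Longrightarrow> v i \<in> carrier_vec n"
    "\<And>i. i < n \<Longrightarrow> A *\<^sub>v v i = d i \<cdot>\<^sub>v v i"
    "\<And>i j. i < n \<Longrightarrow> j < n \<Longrightarrow> inner n (v i) (v j) = (if i = j then 1 else 0)"
    using vd by auto
  note Ac = unitary_matD(1)[OF A]
  define W where "W = mat n n (\<lambda>(i, j). v j $ i)"
  have Wc: "W \<in> carrier_mat n n" by (simp add: W_def)
  have "mat_adjoint W * W = 1\<^sub>m n"
  proof (rule eq_matI)
    fix i j assume "i < dim_row (1\<^sub>m n)" "j < dim_col (1\<^sub>m n)"
    then have ij: "i < n" "j < n" by auto
    have "(mat_adjoint W * W) $$ (i, j) = inner n (v j) (v i)"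
      unfolding index_mult[OF mat_adjoint_carrier[OF Wc] Wc ij] inner_def
      using ij Wc by (intro sum.cong refl) (simp add: W_def mult.commute)
    then show "(mat_adjoint W * W) $$ (i, j) = 1\<^sub>m n $$ (i, j)" using ij v(3) by auto
  qed (use Wc in auto)
  then have W: "unitary_mat n W" by (rule unitary_matI[OF Wc])
  have "A * W = W * mat_diag n d"
  proof (rule eq_matI)
    fix i j assume "i < dim_row (W * mat_diag n d)" "j < dim_col (W * mat_diag n d)"
    then have ij: "i < n" "j < n" using Wc by (auto simp: mat_diag_def)
    have "(A * W) $$ (i, j) = (A *\<^sub>v v j) $ i"
      unfolding index_mult[OF Ac Wc ij] index_mult_vec[OF Ac v(1)[OF ij(2)] ij(1)]
      using ij by (simp add: W_def)
    also have "\<dots> = (W * mat_diag n d) $$ (i, j)"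
      using ij v(1)[OF ij(2)] unfolding mat_diag_mult_right[OF Wc]
      by (simp add: v(2) W_def)
    finally show "(A * W) $$ (i, j) = (W * mat_diag n d) $$ (i, j)" .
  qed (use Wc Ac in \<open>auto simp: mat_diag_def\<close>)
  then have "W * mat_diag n d * mat_adjoint W = A * (W * mat_adjoint W)"
    using Ac Wc by (simp add: assoc_mult_mat[of _ n n _ n _ n, symmetric])
  then have "A = W * mat_diag n d * mat_adjoint W"
    using unitary_matD[OF W] Ac by simp
  then have "diagonalized n A (mat_adjoint W) d"
    using unitary_mat_adjoint[OF W] by (simp add: diagonalized_def)
  then show ?thesis by blast
qed

lemma index_diagonalized:
  assumes W: "W \<in> carrier_mat n n" and ij: "i < n" "j < n"
  shows "(mat_adjoint W * mat_diag n f * W) $$ (i, j) = (\<Sum>l<n. cnj (W $$ (l, i)) * f l * W $$ (l, j))"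
proof -
  have "mat_adjoint W * mat_diag n f \<in> carrier_mat n n"
    by (rule mult_carrier_mat[of _ n n]) (use W in auto)
  from index_mult[OF this W ij] show ?thesis
    using W ij by (simp add: mat_diag_mult_right[OF mat_adjoint_carrier[OF W]] del: index_mult_mat)
qed

lemma unitary_conjugation_eq_iff:
  assumes W: "unitary_mat n W" and B: "B \<in> carrier_mat n n" and C: "C \<in> carrier_mat n n"
  shows "mat_adjoint W * B * W = C \<longleftrightarrow> B = W * C * mat_adjoint W"
proof -
  note [simp] = unitary_matD[OF W] B C
  note [simp] = mult_carrier_mat[of _ n n _ n]
  have 1: "W * (mat_adjoint W * B * W) * mat_adjoint W = (W * mat_adjoint W) * B * (W * mat_adjoint W)"
    by (simp only: assoc_mult_mat[of _ n n _ n _ n] unitary_matD(1,2)[OF W] B mult_carrier_mat[of _ n n _ n])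
  have 2: "mat_adjoint W * (W * C * mat_adjoint W) * W = (mat_adjoint W * W) * C * (mat_adjoint W * W)"
    by (simp only: assoc_mult_mat[of _ n n _ n _ n] unitary_matD(1,2)[OF W] C mult_carrier_mat[of _ n n _ n])
  show ?thesis
  proof
    assume "mat_adjoint W * B * W = C"
    then show "B = W * C * mat_adjoint W" using 1 by (simp add: left_mult_one_mat[OF B] right_mult_one_mat[OF B])
  next
    assume "B = W * C * mat_adjoint W"
    then show "mat_adjoint W * B * W = C" using 2 by (simp add: left_mult_one_mat[OF C] right_mult_one_mat[OF C])
  qed
qed

lemma pow_diagonalized:
  assumes "diagonalized n A W d"
  shows "A ^\<^sub>m k = mat_adjoint W * mat_diag n (\<lambda>i. d i ^ k) * W"
proof (induction k)
  case 0
  then show ?case using assms unitary_matD[of n W] diagonalized_carrier[OF assms]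
    by (simp add: diagonalized_def)
next
  case (Suc k)
  let ?D = "mat_diag n (\<lambda>i. d i ^ k)" and ?E = "mat_diag n d"
  have W: "unitary_mat n W" and A: "A = mat_adjoint W * ?E * W"
    using assms by (auto simp: diagonalized_def)
  have "A ^\<^sub>m Suc k = (mat_adjoint W * ?D * W) * (mat_adjoint W * ?E * W)"
    by (simp add: Suc flip: A)
  also have "\<dots> = mat_adjoint W * (?D * ((W * mat_adjoint W) * (?E * W)))"
    by (simp only: assoc_mult_mat[of _ n n _ n _ n] unitary_matD(1,2)[OF W] mat_diag_dim mult_carrier_mat[of _ n n _ n])
  also have "\<dots> = mat_adjoint W * (?D * (?E * W))"
    by (simp add: unitary_matD[OF W] left_mult_one_mat[of _ n n] mult_carrier_mat[of _ n n _ n])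
  also have "\<dots> = mat_adjoint W * (?D * ?E) * W"
    by (simp only: assoc_mult_mat[of _ n n _ n _ n] unitary_matD(1,2)[OF W] mat_diag_dim mult_carrier_mat[of _ n n _ n])
  finally show ?case by (simp add: mult.commute)
qed

lemma poly_mat_diagonalized:
  assumes "diagonalized n A W d"
  shows "poly_mat n q A = mat_adjoint W * mat_diag n (\<lambda>i. poly q (d i)) * W"
proof (rule eq_matI)
  have W: "W \<in> carrier_mat n n" using assms by (auto simp: diagonalized_def unitary_mat_def)
  fix i j assume "i < dim_row (mat_adjoint W * mat_diag n (\<lambda>i. poly q (d i)) * W)"
    "j < dim_col (mat_adjoint W * mat_diag n (\<lambda>i. poly q (d i)) * W)"
  then have ij: "i < n" "j < n" using W by auto
  have "poly_mat n q A $$ (i, j) =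
      (\<Sum>k\<le>degree q. \<Sum>l<n. coeff q k * (cnj (W $$ (l, i)) * d l ^ k * W $$ (l, j)))"
    using ij by (simp add: poly_mat_def pow_diagonalized[OF assms] index_diagonalized[OF W] sum_distrib_left
        del: index_mult_mat)
  also have "\<dots> = (\<Sum>l<n. cnj (W $$ (l, i)) * poly q (d l) * W $$ (l, j))"
    by (subst sum.swap) (simp add: poly_altdef sum_distrib_left sum_distrib_right mult_ac)
  finally show "poly_mat n q A $$ (i, j) = (mat_adjoint W * mat_diag n (\<lambda>i. poly q (d i)) * W) $$ (i, j)"
    using ij by (simp add: index_diagonalized[OF W] del: index_mult_mat)
qed (use assms in \<open>auto simp: poly_mat_def diagonalized_def unitary_mat_def\<close>)

lemma mat_diag_eq_iff: "mat_diag n f = mat_diag n g \<longleftrightarrow> (\<forall>i<n. f i = g i)"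
proof
  assume e: "mat_diag n f = mat_diag n g"
  show "\<forall>i<n. f i = g i"
  proof (intro allI impI)
    fix i assume "i < n"
    then show "f i = g i" using arg_cong[OF e, of "\<lambda>M. M $$ (i, i)"] by (simp add: mat_diag_def)
  qed
qed (auto simp: mat_diag_def)

lemma poly_mat_diagonalized_eq_0_iff:
  assumes "diagonalized n A W d"
  shows "poly_mat n q A = 0\<^sub>m n n \<longleftrightarrow> (\<forall>i<n. poly q (d i) = 0)"
proof -
  have W: "unitary_mat n W" using assms by (auto simp: diagonalized_def)
  have "poly_mat n q A = 0\<^sub>m n n \<longleftrightarrow> mat_diag n (\<lambda>i. poly q (d i)) = W * 0\<^sub>m n n * mat_adjoint W"
    unfolding poly_mat_diagonalized[OF assms] by (rule unitary_conjugation_eq_iff[OF W]) auto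
  also have "W * 0\<^sub>m n n * mat_adjoint W = mat_diag n (\<lambda>i. 0)"
    using unitary_matD[OF W] by (auto simp: mat_diag_def)
  finally show ?thesis by (simp add: mat_diag_eq_iff)
qed

text \<open>Every eigenvalue is a root of \<open>q\<close>, and the product of the linear factors
  over the distinct eigenvalues annihilates \<open>A\<close>.\<close>

lemma degree_minimal_poly_diagonalized:
  assumes A: "diagonalized n A W d" and q: "is_minimal_poly n A q"
  shows "card (d ` {..<n}) = degree q"
proof (rule antisym)
  have q0: "q \<noteq> 0" using q by (auto simp: is_minimal_poly_def)
  have "d ` {..<n} \<subseteq> {z. poly q z = 0}"
    using q poly_mat_diagonalized_eq_0_iff[OF A, of q] by (auto simp: is_minimal_poly_def)
  then show "card (d ` {..<n}) \<le> degree q"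
    using card_mono[OF poly_roots_finite[OF q0]] card_poly_roots_bound[OF q0] by (meson le_trans)
  let ?p = "\<Prod>z\<in>d ` {..<n}. [:-z, 1:]"
  have "poly_mat n ?p A = 0\<^sub>m n n"
    unfolding poly_mat_diagonalized_eq_0_iff[OF A] by (auto simp: poly_prod prod_zero_iff)
  moreover have "?p \<noteq> 0" by (simp add: prod_zero_iff)
  ultimately have "degree q \<le> degree ?p" using q by (auto simp: is_minimal_poly_def)
  also have "degree ?p = card (d ` {..<n})" by (subst degree_prod_eq_sum_degree) auto
  finally show "degree q \<le> card (d ` {..<n})" .
qed

lemma similar_mat_diagonalized:
  assumes "diagonalized n A W d" shows "similar_mat A (mat_diag n d)"
  using assms unitary_matD[of n W] diagonalized_carrier[OF assms]
  by (intro similar_matI[of _ _ "mat_adjoint W" W n]) (auto simp: diagonalized_def)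

text \<open>A diagonal matrix is a Jordan matrix with blocks of size 1; this gives access to the
  dimension formula for eigenspaces of Jordan matrices.\<close>

lemma jordan_matrix_diag:
  "jordan_matrix (map (\<lambda>a. (1, a)) as) = mat_diag (length as) (\<lambda>i. as ! i)"
proof (induction as)
  case Nil
  then show ?case by (auto simp: jordan_matrix_def mat_diag_def)
next
  case (Cons a as)
  have s: "sum_list (map fst (map (\<lambda>a. (1::nat, a)) as)) = length as"
    by (induction as) auto
  show ?case
    unfolding list.map jordan_matrix_Cons s Cons
    by (rule eq_matI) (auto simp: mat_diag_def jordan_block_def nth_Cons' four_block_mat_def)
qed

text \<open>The eigenspace is the generalized eigenspace of order 1, whose dimension is invariant
  under similarity. For Jordan blocks of size 1 the dimension formula counts the blocks with
  eigenvalue \<open>a\<close>.\<close>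

lemma eigen_mult_diagonalized:
  assumes A: "diagonalized n A W d"
  shows "eigen_mult A a = card {i. i < n \<and> d i = a}"
proof -
  let ?as = "map d [0..<n]"
  have "mat_diag n d = jordan_matrix (map (\<lambda>a. (1, a)) ?as)"
    unfolding jordan_matrix_diag by (auto simp: mat_diag_def)
  then have "dim_gen_eigenspace A a 1 =
      dim_gen_eigenspace (jordan_matrix (map (\<lambda>a. (1, a)) ?as)) a 1"
    using dim_gen_eigenspace_similar[OF similar_mat_diagonalized[OF A]] by simp
  also have "\<dots> = length (filter (\<lambda>e. e = a) ?as)"
    unfolding dim_gen_eigenspace_jordan_matrix by (induction ?as) (auto simp: o_def filter_map sum_list_triv)
  also have "\<dots> = card {i. i < n \<and> d i = a}"
    by (auto simp: length_filter_conv_card intro: arg_cong[where f = card])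
  finally show ?thesis
    using diagonalized_carrier[OF A] by (simp add: eigen_mult_def dim_gen_eigenspace_def char_matrix_def)
qed

lemma spectrum_diagonalized:
  assumes A: "diagonalized n A W d" shows "spectrum A = d ` {..<n}"
proof -
  have "upper_triangular (mat_diag n d)" by (auto simp: mat_diag_def)
  then have "char_poly A = (\<Prod>a\<leftarrow>diag_mat (mat_diag n d). [:- a, 1:])"
    unfolding char_poly_similar[OF similar_mat_diagonalized[OF A]]
    by (rule char_poly_upper_triangular[OF mat_diag_dim])
  also have "diag_mat (mat_diag n d) = map d [0..<n]"
    by (auto simp: diag_mat_def mat_diag_def)
  finally have "poly (char_poly A) z = 0 \<longleftrightarrow> z \<in> d ` {..<n}" for z
    by (auto simp: poly_prod_list prod_list_zero_iff)
  then show ?thesis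
    using eigenvalue_root_char_poly[OF diagonalized_carrier[OF A]] by (auto simp: spectrum_def)
qed

lemma max_mult_diagonalized:
  assumes A: "diagonalized n A W d"
  shows "max_mult A = Max ((\<lambda>a. card {i. i < n \<and> d i = a}) ` d ` {..<n})"
  by (simp add: max_mult_def spectrum_diagonalized[OF A] eigen_mult_diagonalized[OF A, abs_def])

text \<open>If only two eigenvalues can occur, the trace determines their multiplicities; this is
  how it is used later.\<close>

lemma trace_diagonalized:
  assumes A: "diagonalized n A W d" shows "(\<Sum>i<n. A $$ (i, i)) = (\<Sum>i<n. d i)"
proof -
  have W: "unitary_mat n W" "A = mat_adjoint W * mat_diag n d * W"
    using A by (auto simp: diagonalized_def)
  note Wc = unitary_matD(1)[OF W(1)]
  have "(\<Sum>i<n. A $$ (i, i)) = (\<Sum>i<n. \<Sum>l<n. cnj (W $$ (l, i)) * d l * W $$ (l, i))"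
    unfolding W(2) by (simp add: index_diagonalized[OF Wc] del: index_mult_mat)
  also have "\<dots> = (\<Sum>l<n. d l * (\<Sum>i<n. W $$ (l, i) * mat_adjoint W $$ (i, l)))"
    using Wc by (subst sum.swap) (simp add: sum_distrib_left mult_ac)
  also have "\<dots> = (\<Sum>l<n. d l * (W * mat_adjoint W) $$ (l, l))"
    by (intro sum.cong refl) (simp add: index_mult[OF Wc mat_adjoint_carrier[OF Wc]] del: index_mult_mat)
  also have "\<dots> = (\<Sum>l<n. d l)"
    using unitary_matD(4)[OF W(1)] by simp
  finally show ?thesis .
qed

section \<open>Unitary orbits and equality of multiplicities\<close>

lemma unitary_orbit_diagonalized:
  assumes A: "diagonalized n A W d" and B: "B \<in> unitary_orbit n A"
  shows "\<exists>X. diagonalized n B X d"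
proof -
  obtain X where X: "unitary_mat n X" "B = mat_adjoint X * A * X"
    using B by (auto simp: unitary_orbit_def)
  have W: "unitary_mat n W" "A = mat_adjoint W * mat_diag n d * W"
    using A by (auto simp: diagonalized_def)
  have "B = (mat_adjoint X * mat_adjoint W) * mat_diag n d * (W * X)"
    unfolding X(2) W(2)
    by (simp only: assoc_mult_mat[of _ n n _ n _ n] unitary_matD(1,2)[OF W(1)] unitary_matD(1,2)[OF X(1)]
        mat_diag_dim mult_carrier_mat[of _ n n _ n])
  then have "diagonalized n B (W * X) d"
    using unitary_mat_mult[OF W(1) X(1)] unitary_matD[OF W(1)] unitary_matD[OF X(1)]
    by (simp add: diagonalized_def mat_adjoint_mult[of _ n n _ n])
  then show ?thesis by blast
qed

lemma unitary_orbit_trans: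
  assumes "B \<in> unitary_orbit n A" "C \<in> unitary_orbit n B" "A \<in> carrier_mat n n"
  shows "C \<in> unitary_orbit n A"
proof -
  obtain X Y where X: "unitary_mat n X" "B = mat_adjoint X * A * X"
    and Y: "unitary_mat n Y" "C = mat_adjoint Y * B * Y"
    using assms by (auto simp: unitary_orbit_def)
  have "C = (mat_adjoint Y * mat_adjoint X) * A * (X * Y)"
    unfolding X(2) Y(2)
    by (simp only: assoc_mult_mat[of _ n n _ n _ n] unitary_matD(1,2)[OF X(1)] unitary_matD(1,2)[OF Y(1)]
        assms mult_carrier_mat[of _ n n _ n])
  then have "C = mat_adjoint (X * Y) * A * (X * Y)"
    using unitary_matD[OF X(1)] unitary_matD[OF Y(1)] by (simp add: mat_adjoint_mult[of _ n n _ n])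
  then show ?thesis using unitary_mat_mult[OF X(1) Y(1)] by (auto simp: unitary_orbit_def)
qed

lemma mat_diag_in_unitary_orbit:
  assumes A: "diagonalized n A W d" shows "mat_diag n d \<in> unitary_orbit n A"
proof -
  have W: "unitary_mat n W" "A = mat_adjoint W * mat_diag n d * W"
    using A by (auto simp: diagonalized_def)
  then have "mat_diag n d = W * A * mat_adjoint W"
    using unitary_conjugation_eq_iff[OF W(1) mat_diag_dim diagonalized_carrier[OF A]] by blast
  then show ?thesis
    using unitary_mat_adjoint[OF W(1)] by (auto simp: unitary_orbit_def intro!: exI[of _ "mat_adjoint W"])
qed

lemma diagonalized_in_unitary_orbit: "diagonalized n A W d \<Longrightarrow> A \<in> unitary_orbit n (mat_diag n d)"
  by (auto simp: diagonalized_def unitary_orbit_def)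

lemma permuted_diag_in_unitary_orbit:
  assumes p: "p permutes {..<n}" and e: "\<And>i. i < n \<Longrightarrow> e i = d (p i)"
  shows "mat_diag n e \<in> unitary_orbit n (mat_diag n d)"
proof -
  \<comment> \<open>The permutation matrix that sends the \<open>j\<close>-th unit vector to the
    \<open>p j\<close>-th one.\<close>
  define X where "X = mat n n (\<lambda>(i, j). if i = p j then 1 else 0 :: complex)"
  have Xc: "X \<in> carrier_mat n n" by (simp add: X_def)
  have pn: "p i < n \<longleftrightarrow> i < n" for i using permutes_in_image[OF p, of i] by simp
  have inj: "p i = p j \<longleftrightarrow> i = j" for i j using permutes_inj[OF p] by (auto simp: inj_eq)
  have c: "mat_adjoint X * mat_diag n f * X = mat_diag n (f \<circ> p)" for f
  proof (rule eq_matI)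
    fix i j assume "i < dim_row (mat_diag n (f \<circ> p))" "j < dim_col (mat_diag n (f \<circ> p))"
    then have ij: "i < n" "j < n" by (auto simp: mat_diag_def)
    have "(mat_adjoint X * mat_diag n f * X) $$ (i, j) =
        (\<Sum>l<n. if l = p i then (if p i = p j then f (p i) else 0) else 0)"
      unfolding index_diagonalized[OF Xc ij] using ij by (intro sum.cong refl) (auto simp: X_def)
    then show "(mat_adjoint X * mat_diag n f * X) $$ (i, j) = mat_diag n (f \<circ> p) $$ (i, j)"
      using ij by (simp add: mat_diag_def pn inj)
  qed (use Xc in \<open>auto simp: mat_diag_def\<close>)
  have "mat_adjoint X * X = mat_adjoint X * mat_diag n (\<lambda>_. 1) * X"
    using Xc by (simp add: right_mult_one_mat[of _ n n])
  also have "\<dots> = 1\<^sub>m n" unfolding c by (simp add: o_def)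
  finally have "unitary_mat n X" by (rule unitary_matI[OF Xc])
  moreover have "mat_diag n e = mat_adjoint X * mat_diag n d * X"
    unfolding c by (simp add: mat_diag_eq_iff e)
  ultimately show ?thesis by (auto simp: unitary_orbit_def)
qed

text \<open>Equal multiplicities give equal multisets of diagonal entries, so the two diagonals
  differ by a permutation. Each matrix is unitarily equivalent to its own diagonal.\<close>

lemma unitary_orbitI:
  assumes A: "diagonalized n A W d" and B: "diagonalized n B X e"
    and eq: "\<And>a. card {i. i < n \<and> d i = a} = card {i. i < n \<and> e i = a}"
  shows "B \<in> unitary_orbit n A"
proof -
  have count: "count (image_mset f (mset_set {..<n})) a = card {i. i < n \<and> f i = a}"
    for f :: "nat \<Rightarrow> complex" and a
  proof -
    have "{i. i < n \<and> f i = a} = f -` {a} \<inter> {..<n}" by auto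
    then show ?thesis by (simp add: count_image_mset)
  qed
  have "image_mset e (mset_set {..<n}) = image_mset d (mset_set {..<n})"
    by (rule multiset_eqI) (simp only: count eq)
  then obtain p where p: "p permutes {..<n}" "\<forall>i\<in>{..<n}. e i = d (p i)"
    using image_mset_eq_implies_permutes[OF finite_lessThan] by blast
  then have "mat_diag n e \<in> unitary_orbit n (mat_diag n d)"
    by (intro permuted_diag_in_unitary_orbit) auto
  then have "mat_diag n e \<in> unitary_orbit n A"
    using mat_diag_in_unitary_orbit[OF A] unitary_orbit_trans diagonalized_carrier[OF A] by blast
  then show ?thesis
    using diagonalized_in_unitary_orbit[OF B] unitary_orbit_trans diagonalized_carrier[OF A] by blast
qed

section \<open>Common eigenvectors as the obstruction\<close>

text \<open>A vector is fixed up to the factor \<open>a\<close> by \<open>A\<close> once its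
  coordinates \<open>(W x) $ i\<close> with \<open>d i \<noteq> a\<close> vanish, and likewise for
  \<open>B\<close>. Together these are fewer than \<open>n\<close> linear conditions.\<close>

lemma exists_common_eigenvector:
  assumes A: "diagonalized n A W d" and B: "diagonalized n B X e"
    and gt: "n < card {i. i < n \<and> d i = a} + card {i. i < n \<and> e i = b}"
  shows "\<exists>x\<in>carrier_vec n. x \<noteq> 0\<^sub>v n \<and> A *\<^sub>v x = a \<cdot>\<^sub>v x \<and> B *\<^sub>v x = b \<cdot>\<^sub>v x"
proof -
  have compl: "card {i. i < n \<and> f i \<noteq> c} = n - card {i. i < n \<and> f i = c}" for f :: "nat \<Rightarrow> complex" and c
  proof -
    have "{i. i < n \<and> f i \<noteq> c} = {..<n} - {i. i < n \<and> f i = c}" by auto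
    then show ?thesis by (simp only:) (subst card_Diff_subset; auto)
  qed
  have le: "card {i. i < n \<and> f i = c} \<le> n" for f :: "nat \<Rightarrow> complex" and c
    using card_mono[of "{..<n}" "{i. i < n \<and> f i = c}"] by auto
  let ?J = "{i. i < n \<and> d i \<noteq> a} <+> {i. i < n \<and> e i \<noteq> b}"
  let ?w = "\<lambda>j l. case j of Inl i \<Rightarrow> W $$ (i, l) | Inr i \<Rightarrow> X $$ (i, l)"
  have "card ?J < n" using gt le[of d a] le[of e b] by (simp add: card_Plus compl)
  then obtain x where x: "x \<in> carrier_vec n" "x \<noteq> 0\<^sub>v n" "\<forall>j\<in>?J. (\<Sum>l<n. ?w j l * x $ l) = 0"
    using exists_common_zero[of ?J n ?w] by auto
  have eig: "M *\<^sub>v x = c \<cdot>\<^sub>v x"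
    if M: "diagonalized n M Y f" and z: "\<And>i. i < n \<Longrightarrow> f i \<noteq> c \<Longrightarrow> (\<Sum>l<n. Y $$ (i, l) * x $ l) = 0"
    for M Y f c
  proof -
    have Y: "unitary_mat n Y" "M = mat_adjoint Y * mat_diag n f * Y"
      using M by (auto simp: diagonalized_def)
    note Yc = unitary_matD(1)[OF Y(1)]
    have Yx: "Y *\<^sub>v x \<in> carrier_vec n" using Yc x by auto
    have D: "mat_diag n f *\<^sub>v (Y *\<^sub>v x) = c \<cdot>\<^sub>v (Y *\<^sub>v x)"
    proof (rule eq_vecI)
      fix i assume "i < dim_vec (c \<cdot>\<^sub>v (Y *\<^sub>v x))"
      then have i: "i < n" using Yc by simp
      have "(mat_diag n f *\<^sub>v (Y *\<^sub>v x)) $ i = (\<Sum>l<n. if l = i then f i * (Y *\<^sub>v x) $ i else 0)"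
        unfolding index_mult_vec[OF mat_diag_dim Yx i] using i
        by (intro sum.cong refl) (auto simp: mat_diag_def)
      also have "\<dots> = f i * (Y *\<^sub>v x) $ i" using i by simp
      also have "\<dots> = c * (Y *\<^sub>v x) $ i"
        using z[OF i] by (auto simp: index_mult_vec[OF Yc x(1) i] simp del: index_mult_mat_vec)
      finally show "(mat_diag n f *\<^sub>v (Y *\<^sub>v x)) $ i = (c \<cdot>\<^sub>v (Y *\<^sub>v x)) $ i"
        using i Yc by simp
    qed (use Yc in \<open>auto simp: mat_diag_def\<close>)
    have "M *\<^sub>v x = mat_adjoint Y *\<^sub>v (mat_diag n f *\<^sub>v (Y *\<^sub>v x))"
      unfolding Y(2) using Yc x by (simp add: assoc_mult_mat_vec[of _ n n _ n] mult_carrier_mat[of _ n n _ n])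
    also have "\<dots> = c \<cdot>\<^sub>v (mat_adjoint Y *\<^sub>v (Y *\<^sub>v x))"
      unfolding D by (rule mult_mat_vec[OF mat_adjoint_carrier[OF Yc] Yx])
    also have "mat_adjoint Y *\<^sub>v (Y *\<^sub>v x) = x"
      using Yc x unitary_matD[OF Y(1)] by (subst assoc_mult_mat_vec[symmetric, of _ n n _ n]) auto
    finally show ?thesis .
  qed
  have "A *\<^sub>v x = a \<cdot>\<^sub>v x" by (rule eig[OF A]) (use bspec[OF x(3) InlI] in simp)
  moreover have "B *\<^sub>v x = b \<cdot>\<^sub>v x" by (rule eig[OF B]) (use bspec[OF x(3) InrI] in simp)
  ultimately show ?thesis using x by blast
qed

lemma smult_mat_mult_vec:
  assumes "M \<in> carrier_mat n m" "x \<in> carrier_vec m"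
  shows "(k \<cdot>\<^sub>m M) *\<^sub>v x = k \<cdot>\<^sub>v (M *\<^sub>v x)"
  using assms by (intro eq_vecI) (auto simp: scalar_prod_def sum_distrib_left mult.assoc)

text \<open>The matrices having \<open>x\<close> as an eigenvector form a subalgebra. It is proper:
  the matrix unit that moves a nonzero coordinate of \<open>x\<close> to another position is
  missing.\<close>

lemma generated_algebra_ne_if_common_eigenvector:
  assumes n: "n \<ge> 2" and A: "A \<in> carrier_mat n n" and B: "B \<in> carrier_mat n n"
    and x: "x \<in> carrier_vec n" "x \<noteq> 0\<^sub>v n" "A *\<^sub>v x = a \<cdot>\<^sub>v x" "B *\<^sub>v x = b \<cdot>\<^sub>v x"
  shows "generated_algebra n {A, B} \<noteq> carrier_mat n n"
proof
  let ?S = "{M \<in> carrier_mat n n. \<exists>c. M *\<^sub>v x = c \<cdot>\<^sub>v x}"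
  have "is_subalgebra n ?S"
    unfolding is_subalgebra_def
  proof (intro conjI ballI allI)
    show "1\<^sub>m n \<in> ?S" using x by (auto intro!: exI[of _ 1])
  next
    fix M M' assume "M \<in> ?S" "M' \<in> ?S"
    then obtain c c' where M: "M \<in> carrier_mat n n" "M *\<^sub>v x = c \<cdot>\<^sub>v x"
      "M' \<in> carrier_mat n n" "M' *\<^sub>v x = c' \<cdot>\<^sub>v x" by auto
    have "(M + M') *\<^sub>v x = (c + c') \<cdot>\<^sub>v x"
      using M x(1) by (simp add: add_mult_distrib_mat_vec[of _ n n] add_smult_distrib_vec)
    then show "M + M' \<in> ?S" using M by auto
    have "(M * M') *\<^sub>v x = (c' * c) \<cdot>\<^sub>v x"
      using M x(1) by (simp add: assoc_mult_mat_vec[of _ n n _ n] mult_mat_vec[of _ n n] smult_smult_assoc)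
    then show "M * M' \<in> ?S" using M by (auto intro: mult_carrier_mat)
  next
    fix k M assume "M \<in> ?S"
    then obtain c where M: "M \<in> carrier_mat n n" "M *\<^sub>v x = c \<cdot>\<^sub>v x" by auto
    have "(k \<cdot>\<^sub>m M) *\<^sub>v x = (k * c) \<cdot>\<^sub>v x"
      using M x(1) by (simp add: smult_mat_mult_vec[of _ n n] M(2) smult_smult_assoc)
    then show "k \<cdot>\<^sub>m M \<in> ?S" using M by auto
  qed auto
  moreover have "{A, B} \<subseteq> ?S" using A B x by auto
  ultimately have "generated_algebra n {A, B} \<subseteq> ?S"
    unfolding generated_algebra_def by (rule hull_minimal[rotated])
  moreover assume "generated_algebra n {A, B} = carrier_mat n n"
  ultimately have all: "\<exists>c. M *\<^sub>v x = c \<cdot>\<^sub>v x" if "M \<in> carrier_mat n n" for M using that by blast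
  have "\<exists>j<n. x $ j \<noteq> 0" using x(1,2) by (metis carrier_vecD eq_vecI index_zero_vec(1,2))
  then obtain j where j: "j < n" "x $ j \<noteq> 0" by blast
  obtain k where k: "k < n" "k \<noteq> j" using n by (metis One_nat_def Suc_1 Suc_le_lessD less_le_trans pos2 zero_neq_one)
  define M where "M = mat n n (\<lambda>(i, l). if i = k \<and> l = j then 1 else 0 :: complex)"
  have M: "M \<in> carrier_mat n n" by (simp add: M_def)
  then obtain c where c: "M *\<^sub>v x = c \<cdot>\<^sub>v x" using all by blast
  have Mi: "(M *\<^sub>v x) $ i = (\<Sum>l<n. if l = j then (if i = k then x $ j else 0) else 0)" if "i < n" for i
    unfolding index_mult_vec[OF M x(1) that] using that by (intro sum.cong refl) (auto simp: M_def)
  have "c * x $ j = 0" using Mi[OF j(1)] c j k x(1) by simp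
  moreover have "c * x $ k = x $ j" using Mi[OF k(1)] c j k x(1) by simp
  ultimately show False using j by simp
qed

section \<open>Algebras of matrices over a finite index set\<close>

text \<open>Allows arbitrary functions, in particular indicators of single eigenvalues, to be
  applied where only polynomials are available.\<close>

lemma exists_interpolation_poly:
  fixes h :: "complex \<Rightarrow> complex"
  assumes "finite Z"
  shows "\<exists>p. \<forall>z\<in>Z. poly p z = h z"
  using assms
proof induction
  case empty
  then show ?case by simp
next
  case (insert z Z)
  then obtain p where p: "\<forall>u\<in>Z. poly p u = h u" by auto
  define q where "q = (\<Prod>u\<in>Z. [:-u, 1:])"
  have qz: "poly q z \<noteq> 0"
    using insert by (auto simp: q_def poly_prod prod_zero_iff)
  have qu: "poly q u = 0" if "u \<in> Z" for u
    using insert that by (auto simp: q_def poly_prod prod_zero_iff)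
  let ?p = "p + Polynomial.smult ((h z - poly p z) / poly q z) q"
  have "\<forall>u\<in>insert z Z. poly ?p u = h u"
    using p qz qu by auto
  then show ?case by blast
qed

definition diag_fun :: "('i \<Rightarrow> complex) \<Rightarrow> 'i \<Rightarrow> 'i \<Rightarrow> complex" where
  "diag_fun f x y = (if x = y then f x else 0)"

definition delta :: "'i \<Rightarrow> 'i \<Rightarrow> complex" where
  "delta a x = (if x = a then 1 else 0)"

lemma delta_simps [simp]: "delta a a = 1" "delta a x = 0 \<longleftrightarrow> x \<noteq> a"
  by (auto simp: delta_def)

lemma sum_delta [simp]:
  assumes "finite A"
  shows "(\<Sum>x\<in>A. f x * delta a x) = (if a \<in> A then f a else 0)"
    and "(\<Sum>x\<in>A. delta a x * f x) = (if a \<in> A then f a else 0)"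
    and "(\<Sum>x\<in>A. f x * delta x a) = (if a \<in> A then f a else 0)"
    and "(\<Sum>x\<in>A. delta x a * f x) = (if a \<in> A then f a else 0)"
  using assms by (simp_all add: delta_def if_distrib if_distribR sum.If_cases Int_def
      cong: if_cong conj_cong)

text \<open>Vectors are total functions of which only the values on \<open>I\<close> count;
  \<open>cong\<close> makes membership blind to the other values.\<close>

locale function_space =
  fixes I :: "'i set" and R :: "('i \<Rightarrow> complex) set"
  assumes fin: "finite I"
    and cong: "\<And>v w. v \<in> R \<Longrightarrow> (\<And>x. x \<in> I \<Longrightarrow> v x = w x) \<Longrightarrow> w \<in> R"
    and add: "\<And>v w. v \<in> R \<Longrightarrow> w \<in> R \<Longrightarrow> (\<lambda>x. v x + w x) \<in> R"
    and scale: "\<And>c v. v \<in> R \<Longrightarrow> (\<lambda>x. c * v x) \<in> R"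
    and zero: "(\<lambda>x. 0) \<in> R"
begin

lemma sum_mem:
  assumes "finite A" "\<And>a. a \<in> A \<Longrightarrow> v a \<in> R"
  shows "(\<lambda>x. \<Sum>a\<in>A. v a x) \<in> R"
  using assms by (induction A) (auto intro: add zero)

lemma diff:
  assumes "v \<in> R" "w \<in> R" shows "(\<lambda>x. v x - w x) \<in> R"
  using add[OF assms(1) scale[OF assms(2), of "-1"]] by simp

lemma scaleD:
  assumes "(\<lambda>x. c * v x) \<in> R" "c \<noteq> 0" shows "v \<in> R"
  using scale[OF assms(1), of "inverse c"] assms(2) by (simp add: mult.assoc[symmetric])

text \<open>On the finite image of \<open>I\<close> under \<open>f\<close>, the function
  \<open>h\<close> agrees with a polynomial, and polynomials in \<open>f\<close> arise by iterated
  multiplication. The predicate \<open>P\<close> limits the closure hypothesis to a class of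
  vectors, such as those supported in one block.\<close>

lemma multiplier_mem:
  assumes mult: "\<And>v. v \<in> R \<Longrightarrow> P v \<Longrightarrow> (\<lambda>x. f x * v x) \<in> R"
    and P: "\<And>v a. P v \<Longrightarrow> P (\<lambda>x. a x * v x)"
    and v: "v \<in> R" "P v"
  shows "(\<lambda>x. h (f x) * v x) \<in> R"
proof -
  have *: "(\<lambda>x. poly p (f x) * v x) \<in> R" for p
  proof (induction p)
    case 0
    then show ?case by (simp add: zero)
  next
    case (pCons a p)
    have "(\<lambda>x. a * v x + f x * (poly p (f x) * v x)) \<in> R"
      using scale[OF v(1), of a] mult[OF pCons(2) P[OF v(2)]] by (intro add) auto
    then show ?case by (simp add: algebra_simps)
  qed
  obtain p where "\<forall>z\<in>f ` I. poly p z = h z"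
    using exists_interpolation_poly[of "f ` I" h] fin by auto
  then show ?thesis by (intro cong[OF *[of p]]) auto
qed

lemma all_mem:
  assumes "\<And>x. x \<in> I \<Longrightarrow> (\<lambda>y. delta x y) \<in> R"
  shows "v \<in> R"
proof -
  have "(\<lambda>y. \<Sum>x\<in>I. v x * delta x y) \<in> R"
    using assms by (intro sum_mem fin scale) auto
  then show ?thesis
    by (rule cong) (simp add: fin)
qed

end

locale function_algebra =
  fixes I :: "'i set" and S :: "('i \<Rightarrow> 'i \<Rightarrow> complex) set"
  assumes fin: "finite I"
    and cong: "\<And>f g. f \<in> S \<Longrightarrow> (\<And>x y. x \<in> I \<Longrightarrow> y \<in> I \<Longrightarrow> f x y = g x y) \<Longrightarrow> g \<in> S"
    and add: "\<And>f g. f \<in> S \<Longrightarrow> g \<in> S \<Longrightarrow> (\<lambda>x y. f x y + g x y) \<in> S"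
    and scale: "\<And>c f. f \<in> S \<Longrightarrow> (\<lambda>x y. c * f x y) \<in> S"
    and mult: "\<And>f g. f \<in> S \<Longrightarrow> g \<in> S \<Longrightarrow> (\<lambda>x y. \<Sum>z\<in>I. f x z * g z y) \<in> S"
    and one: "diag_fun (\<lambda>_. 1) \<in> S"
begin

lemma zero: "(\<lambda>x y. 0) \<in> S"
  using scale[OF one, of 0] by simp

lemma mult_diag_left:
  assumes "diag_fun f \<in> S" "g \<in> S"
  shows "(\<lambda>x y. f x * g x y) \<in> S"
  by (rule cong[OF mult[OF assms]]) (simp add: diag_fun_def fin if_distrib if_distribR cong: if_cong)

lemma mult_diag_right:
  assumes "diag_fun f \<in> S" "g \<in> S"
  shows "(\<lambda>x y. g x y * f y) \<in> S"
  by (rule cong[OF mult[OF assms(2,1)]]) (simp add: diag_fun_def fin if_distrib cong: if_cong)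

text \<open>The diagonals lying in \<open>S\<close> form a function space that contains the constant
  1 and is closed under multiplication by \<open>f\<close>, so \<open>multiplier_mem\<close>
  applies.\<close>

lemma diag_calculus:
  assumes "diag_fun f \<in> S"
  shows "diag_fun (\<lambda>x. h (f x)) \<in> S"
proof -
  interpret D: function_space I "{v. diag_fun v \<in> S}"
  proof (unfold_locales, goal_cases)
    case 1 show ?case by (rule fin)
  next
    case (2 v w) then show ?case by (auto simp: diag_fun_def intro: cong)
  next
    case (3 v w)
    then have "(\<lambda>x y. diag_fun v x y + diag_fun w x y) \<in> S" by (intro add) auto
    then show ?case by (auto simp: diag_fun_def elim!: cong)
  next
    case (4 c v)
    then have "(\<lambda>x y. c * diag_fun v x y) \<in> S" by (intro scale) auto
    then show ?case by (auto simp: diag_fun_def elim!: cong)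
  next
    case 5
    show ?case using zero by (auto simp: diag_fun_def elim!: cong)
  qed
  have "(\<lambda>x. h (f x) * 1) \<in> {v. diag_fun v \<in> S}"
  proof (rule D.multiplier_mem[where P = "\<lambda>_. True" and f = f and h = h and v = "\<lambda>_. 1"])
    fix v assume "v \<in> {v. diag_fun v \<in> S}"
    then have "(\<lambda>x y. f x * diag_fun v x y) \<in> S"
      using mult_diag_left[OF assms] by auto
    then show "(\<lambda>x. f x * v x) \<in> {v. diag_fun v \<in> S}"
      by (auto simp: diag_fun_def elim!: cong)
  qed (use one in auto)
  then show ?thesis by simp
qed

text \<open>Placing vectors in a fixed column \<open>a\<close> turns \<open>S\<close> into a space
  of vectors on which the elements of \<open>S\<close> act by left multiplication; rows are treated
  alike below.\<close>

lemma function_space_col: "function_space I {v. (\<lambda>x y. v x * delta a y) \<in> S}"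
proof (unfold_locales, goal_cases)
  case 1 show ?case by (rule fin)
next
  case (2 v w) then show ?case by (auto intro: cong)
next
  case (3 v w) then show ?case using add[of "\<lambda>x y. v x * delta a y"] by (auto simp: distrib_right)
next
  case (4 c v) then show ?case using scale[of "\<lambda>x y. v x * delta a y"] by (auto simp: mult.assoc)
next
  case 5 then show ?case using zero by simp
qed

lemma function_space_row: "function_space I {v. (\<lambda>x y. delta a x * v y) \<in> S}"
proof (unfold_locales, goal_cases)
  case 1 show ?case by (rule fin)
next
  case (2 v w) then show ?case by (auto intro: cong)
next
  case (3 v w) then show ?case using add[of "\<lambda>x y. delta a x * v y"] by (auto simp: distrib_left)
next
  case (4 c v) then show ?case using scale[of "\<lambda>x y. delta a x * v y" c]
    by (auto simp: mult.left_commute)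
next
  case 5 then show ?case using zero by simp
qed

text \<open>The rank-one matrix with entries \<open>v x * w y\<close> is the product of a matrix
  supported in column \<open>a\<close> and one supported in row \<open>a\<close>; every matrix is a
  sum of rank-one matrices.\<close>

lemma all_mem:
  assumes a: "a \<in> I"
    and col: "\<And>v. (\<lambda>x y. v x * delta a y) \<in> S"
    and row: "\<And>v. (\<lambda>x y. delta a x * v y) \<in> S"
  shows "g \<in> S"
proof -
  have outer: "(\<lambda>x y. v x * w y) \<in> S" for v w
    by (rule cong[OF mult[OF col[of v] row[of w]]])
      (simp add: a fin delta_def if_distrib if_distribR cong: if_cong)
  have "(\<lambda>x y. \<Sum>z\<in>A. delta z x * g z y) \<in> S" if "finite A" for A
    using that
  proof induction
    case empty
    then show ?case using zero by simp
  next
    case (insert z A)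
    then show ?case using add[OF outer[of "\<lambda>x. delta z x" "g z"] insert.IH] insert.hyps by (simp del: sum_delta)
  qed
  from this[OF fin] show ?thesis
    by (rule cong) (simp add: fin)
qed

end

section \<open>The linking projection\<close>

text \<open>\<open>\<tau>_inj\<close> isolates the coordinates of the first block,
  \<open>link\<close> connects them through block 1, and \<open>F_row\<close> makes each row of the
  reflection visible from a column in \<open>N\<close>. By \<open>\<gamma>_cases\<close> a nonzero
  weight \<open>\<gamma> b j * \<gamma> b j\<close> is either simple or equal to 1. In the latter
  case all positions of weight 1 lie in \<open>N\<close>, and a column of other weight, given by
  \<open>\<gamma>_ne_1\<close>, helps to separate them.\<close>

locale linked_projection =
  fixes r :: nat and N :: "nat set" and \<gamma> :: "nat \<Rightarrow> nat \<Rightarrow> complex"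
    and \<tau> \<kappa> w :: "nat \<Rightarrow> complex"
  assumes N_sub: "N \<subseteq> {..<r}" and N_ne: "N \<noteq> {}"
    and w_unit: "(\<Sum>j<r. w j * w j) = 1" and w_nz: "\<And>j. j < r \<Longrightarrow> w j \<noteq> 0"
    and \<tau>_zero: "\<And>l. l \<notin> N \<Longrightarrow> \<tau> l = 0"
    and \<tau>_nz: "\<And>l. l \<in> N \<Longrightarrow> \<tau> l \<noteq> 0"
    and \<tau>_inj: "inj_on (\<lambda>l. \<tau> l * \<tau> l) N"
    and \<tau>\<kappa>: "\<And>l. l < r \<Longrightarrow> \<tau> l * \<tau> l + \<kappa> l * \<kappa> l = 1"
    and \<kappa>_nz: "\<And>l. l < r \<Longrightarrow> \<kappa> l \<noteq> 0"
    and \<gamma>_sum: "\<And>j. j < r \<Longrightarrow> \<gamma> 1 j * \<gamma> 1 j + \<gamma> 2 j * \<gamma> 2 j = 1"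
    and \<gamma>_cases: "\<And>b j. b \<in> {1, 2} \<Longrightarrow> j < r \<Longrightarrow> \<gamma> b j \<noteq> 0 \<Longrightarrow>
      (\<forall>k<r. \<gamma> b k * \<gamma> b k = \<gamma> b j * \<gamma> b j \<longrightarrow> k = j) \<or>
      (\<gamma> b j * \<gamma> b j = 1 \<and> (\<forall>k<r. \<gamma> b k * \<gamma> b k = 1 \<longrightarrow> k \<in> N))"
    and \<gamma>_ne_1: "\<And>b. b \<in> {1, 2} \<Longrightarrow> \<exists>i\<in>N. \<gamma> b i * \<gamma> b i \<noteq> 1"
    and F_row: "\<And>j. j < r \<Longrightarrow> \<exists>i\<in>N. delta j i - 2 * w j * w i \<noteq> 0"
    and link: "\<And>i k. i \<in> N \<Longrightarrow> k \<in> N \<Longrightarrow> i \<noteq> k \<Longrightarrow>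
      (\<Sum>j<r. \<gamma> 1 j * \<gamma> 1 j * (delta j i - 2 * w j * w i) * (delta j k - 2 * w j * w k)) \<noteq> 0"
begin

definition F :: "nat \<Rightarrow> nat \<Rightarrow> complex" where
  "F j l = delta j l - 2 * w j * w l"

definition C :: "nat \<Rightarrow> nat set" where
  "C b = {j. j < r \<and> \<gamma> b j \<noteq> 0}"

text \<open>A coordinate is a block number with a position. Positions where \<open>T\<close> has a
  zero row are left out, which gives the blocks the sizes of \<open>N\<close>, \<open>C 1\<close>
  and \<open>C 2\<close>.\<close>

definition I :: "(nat \<times> nat) set" where
  "I = {0} \<times> N \<union> ({1} \<times> C 1 \<union> {2} \<times> C 2)"

text \<open>The reflection enters only blocks 1 and 2, so the compression of \<open>p\<close> to
  block 0 stays diagonal.\<close>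

definition T :: "nat \<times> nat \<Rightarrow> nat \<Rightarrow> complex" where
  "T x l = (if fst x = 0 then \<tau> l * delta (snd x) l else \<gamma> (fst x) (snd x) * F (snd x) l * \<kappa> l)"

definition p :: "nat \<times> nat \<Rightarrow> nat \<times> nat \<Rightarrow> complex" where
  "p x y = (\<Sum>l<r. T x l * T y l)"

lemma p_sym: "p x y = p y x"
  by (simp add: p_def mult.commute)

lemma finite_N: "finite N"
  using N_sub finite_subset by blast

lemma finite_C: "finite (C b)"
  by (simp add: C_def)

lemma finite_I: "finite I"
  by (simp add: I_def finite_N finite_C)

lemma sum_I: "(\<Sum>x\<in>I. f x) = (\<Sum>i\<in>N. f (0, i)) + ((\<Sum>j\<in>C 1. f (1, j)) + (\<Sum>j\<in>C 2. f (2, j)))"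
  for f :: "_ \<Rightarrow> complex"
proof -
  have *: "(\<Sum>x\<in>{b} \<times> A. f x) = (\<Sum>j\<in>A. f (b, j))" for b :: nat and A :: "nat set"
  proof -
    have "{b} \<times> A = Pair b ` A" by auto
    then show ?thesis by (simp add: sum.reindex inj_on_def)
  qed
  show ?thesis
    unfolding I_def by (subst sum.union_disjoint; (subst sum.union_disjoint)?)
      (auto simp: finite_N finite_C *)
qed

lemma sum_C: "(\<Sum>j\<in>C b. \<gamma> b j * f j) = (\<Sum>j<r. \<gamma> b j * f j)"
  by (rule sum.mono_neutral_left) (auto simp: C_def)

lemma sum_N: "(\<Sum>l\<in>N. \<tau> l * f l) = (\<Sum>l<r. \<tau> l * f l)"
  by (rule sum.mono_neutral_left) (use N_sub \<tau>_zero in auto)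

lemma F_sym: "F j l = F l j"
  by (simp add: F_def delta_def)

text \<open>\<open>F\<close> is the reflection in the hyperplane orthogonal to the unit vector
  \<open>w\<close>, hence symmetric with square 1.\<close>

lemma F_orth:
  assumes "j < r" "m < r" shows "(\<Sum>l<r. F j l * F m l) = delta j m"
proof -
  have "(\<Sum>l<r. F j l * F m l) =
      (\<Sum>l<r. delta j l * delta m l - 2 * w m * (delta j l * w l) - 2 * w j * (w l * delta m l)
        + 4 * w j * w m * (w l * w l))"
    by (intro sum.cong refl) (simp add: F_def algebra_simps)
  also have "\<dots> = delta j m"
    using assms by (simp add: sum.distrib sum_subtractf sum_distrib_left[symmetric] w_unit)
  finally show ?thesis .
qed

text \<open>Blocks 1 and 2 together contribute \<kappa> F (\<gamma>1^2 + \<gamma>2^2) F \<kappa> =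
  \<kappa>^2, and block 0 contributes \<tau>^2; the sum is 1.\<close>

lemma T_isometry:
  assumes "l < r" "m < r" shows "(\<Sum>x\<in>I. T x l * T x m) = delta l m"
proof -
  have 0: "(\<Sum>i\<in>N. T (0, i) l * T (0, i) m) = \<tau> l * \<tau> l * delta l m"
  proof -
    have "(\<Sum>i\<in>N. T (0, i) l * T (0, i) m) = (\<Sum>i\<in>N. delta i l * (\<tau> l * \<tau> m * delta i m))"
      by (simp add: T_def algebra_simps)
    also have "\<dots> = \<tau> l * \<tau> l * delta l m"
      using \<tau>_zero[of l] by (simp only: sum_delta finite_N) (auto simp: delta_def)
    finally show ?thesis .
  qed
  have b: "(\<Sum>j\<in>C b. T (b, j) l * T (b, j) m) =
      (\<Sum>j<r. \<gamma> b j * \<gamma> b j * (\<kappa> l * \<kappa> m * F j l * F j m))" if "b \<noteq> 0" for b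
    using that sum_C[of b "\<lambda>j. \<gamma> b j * (\<kappa> l * \<kappa> m * F j l * F j m)"]
    by (simp add: T_def algebra_simps)
  have "(\<Sum>x\<in>I. T x l * T x m) = \<tau> l * \<tau> l * delta l m +
      (\<Sum>j<r. (\<gamma> 1 j * \<gamma> 1 j + \<gamma> 2 j * \<gamma> 2 j) * (\<kappa> l * \<kappa> m * F j l * F j m))"
    unfolding sum_I 0 by (simp add: b sum.distrib distrib_right)
  also have "(\<Sum>j<r. (\<gamma> 1 j * \<gamma> 1 j + \<gamma> 2 j * \<gamma> 2 j) * (\<kappa> l * \<kappa> m * F j l * F j m)) =
      \<kappa> l * \<kappa> m * (\<Sum>j<r. F l j * F m j)"
    using \<gamma>_sum by (simp add: sum_distrib_left F_sym[of _ l] F_sym[of _ m] mult.assoc)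
  also have "\<dots> = \<kappa> l * \<kappa> l * delta l m"
    using F_orth[OF assms] by (simp add: delta_def)
  finally show ?thesis
    using \<tau>\<kappa>[OF assms(1)] by (simp add: distrib_right[symmetric])
qed

text \<open>\<open>p\<close> is the product of \<open>T\<close> and its transpose, and the isometry
  property collapses the two middle factors.\<close>

lemma p_idem: "(\<Sum>z\<in>I. p x z * p z y) = p x y"
proof -
  have "(\<Sum>z\<in>I. p x z * p z y) = (\<Sum>z\<in>I. \<Sum>l<r. \<Sum>m<r. T x l * T y m * (T z l * T z m))"
    by (simp add: p_def sum_product algebra_simps)
  also have "\<dots> = (\<Sum>l<r. \<Sum>z\<in>I. \<Sum>m<r. T x l * T y m * (T z l * T z m))"
    by (rule sum.swap)
  also have "\<dots> = (\<Sum>l<r. \<Sum>m<r. \<Sum>z\<in>I. T x l * T y m * (T z l * T z m))"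
    by (intro sum.cong refl sum.swap)
  also have "\<dots> = (\<Sum>l<r. \<Sum>m<r. T x l * T y m * (\<Sum>z\<in>I. T z l * T z m))"
    by (simp add: sum_distrib_left)
  also have "\<dots> = (\<Sum>l<r. \<Sum>m<r. T x l * T y m * delta l m)"
    by (intro sum.cong refl) (simp add: T_isometry)
  also have "\<dots> = p x y"
    by (simp add: p_def)
  finally show ?thesis .
qed

lemma p_trace: "(\<Sum>x\<in>I. p x x) = of_nat r"
  unfolding p_def by (subst sum.swap) (simp add: T_isometry delta_def)

lemma p_0:
  assumes "i \<in> N" shows "p x (0, i) = T x i * \<tau> i"
proof -
  have "p x (0, i) = (\<Sum>l<r. delta i l * (T x l * \<tau> l))"
    by (simp add: p_def T_def algebra_simps)
  then show ?thesis using assms N_sub by (subst (asm) sum_delta) auto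
qed

definition blk :: "nat \<Rightarrow> (nat \<Rightarrow> complex) \<Rightarrow> nat \<times> nat \<Rightarrow> complex" where
  "blk b z x = (if fst x = b then z (snd x) else 0)"

end

section \<open>Spaces invariant under the linking projection\<close>

text \<open>Abstracts from columns and rows of the generated algebra: by symmetry of
  \<open>p\<close> both satisfy the same closure conditions, so one argument covers them.\<close>

locale linked_module = linked_projection + function_space I R for R +
  assumes P: "\<And>v. v \<in> R \<Longrightarrow> (\<lambda>x. \<Sum>y\<in>I. p x y * v y) \<in> R"
    and Q: "\<And>b v. v \<in> R \<Longrightarrow> b \<in> {0, 1, 2} \<Longrightarrow> (\<lambda>x. if fst x = b then v x else 0) \<in> R"
    and E: "\<And>i v. v \<in> R \<Longrightarrow> i \<in> N \<Longrightarrow> (\<lambda>x. delta (0, i) x * v x) \<in> R"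
    and start: "\<exists>i\<in>N. delta (0, i) \<in> R"
begin

text \<open>Applying \<open>p\<close> to a unit vector of block 0 and cutting down to block
  \<open>b\<close> yields this vector times the nonzero scalar
  \<open>\<tau> i * \<kappa> i\<close>.\<close>

lemma column_mem:
  assumes "delta (0, i) \<in> R" "i \<in> N" "b \<in> {1, 2}"
  shows "blk b (\<lambda>j. \<gamma> b j * F j i) \<in> R"
proof -
  have i: "(0, i) \<in> I" "i < r" using assms N_sub by (auto simp: I_def)
  have "(\<lambda>x. if fst x = b then \<Sum>y\<in>I. p x y * delta (0, i) y else 0) \<in> R"
    using assms by (intro Q P) auto
  then have "(\<lambda>x. (\<tau> i * \<kappa> i) * blk b (\<lambda>j. \<gamma> b j * F j i) x) \<in> R"
    by (rule cong) (use assms i in \<open>auto simp: finite_I p_0 T_def blk_def\<close>)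
  then show ?thesis by (rule scaleD) (use \<tau>_nz assms i \<kappa>_nz in auto)
qed

text \<open>The way from \<open>(0, i)\<close> through block 1 back to \<open>(0, k)\<close> has the
  coefficient \<open>\<tau> k * \<kappa> k\<close> times the entry at \<open>(i, k)\<close> of F
  \<gamma>1^2 F, which \<open>link\<close> keeps away from 0.\<close>

lemma base_mem:
  assumes k: "k \<in> N" shows "delta (0, k) \<in> R"
proof -
  obtain i where i: "i \<in> N" "delta (0, i) \<in> R" using start by blast
  show ?thesis
  proof (cases "i = k")
    case False
    have kI: "(0, k) \<in> I" "k < r" using k N_sub by (auto simp: I_def)
    let ?u = "blk 1 (\<lambda>j. \<gamma> 1 j * F j i)"
    have "?u \<in> R" using i by (intro column_mem) auto
    then have "(\<lambda>x. delta (0, k) x * (\<Sum>y\<in>I. p x y * ?u y)) \<in> R"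
      using k by (intro E P)
    then have "(\<lambda>x. (\<Sum>y\<in>I. p (0, k) y * ?u y) * delta (0, k) x) \<in> R"
      by (rule cong) (auto simp: delta_def)
    moreover have "(\<Sum>y\<in>I. p (0, k) y * ?u y) \<noteq> 0"
    proof -
      have "(\<Sum>y\<in>I. p (0, k) y * ?u y) = (\<Sum>j\<in>C 1. \<gamma> 1 j * (p (1, j) (0, k) * F j i))"
        by (simp add: sum_I blk_def p_sym[of "(0, k)"] mult_ac)
      also have "\<dots> = (\<Sum>j<r. \<gamma> 1 j * (p (1, j) (0, k) * F j i))"
        by (rule sum_C)
      also have "\<dots> = \<tau> k * \<kappa> k * (\<Sum>j<r. \<gamma> 1 j * \<gamma> 1 j * F j i * F j k)"
        using k by (simp add: p_0 T_def sum_distrib_left mult_ac)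
      also have "\<dots> \<noteq> 0"
        using \<tau>_nz[OF k] \<kappa>_nz[OF kI(2)] link[OF i(1) k False] by (simp add: F_def mult_ac)
      finally show ?thesis .
    qed
    ultimately show ?thesis by (rule scaleD)
  qed (use i in simp)
qed

text \<open>On the blocks 1 and 2 the compression of \<open>p\<close> is \<open>\<gamma>\<^sup>2\<close> minus an operator with range in
  the columns already known to lie in \<open>R\<close>.\<close>

lemma weight_mem:
  assumes b: "b \<in> {1, 2}" and v: "v \<in> R" "\<And>x. fst x \<noteq> b \<Longrightarrow> v x = 0"
  shows "(\<lambda>x. \<gamma> (fst x) (snd x) * \<gamma> (fst x) (snd x) * v x) \<in> R"
proof -
  \<comment> \<open>\<zeta> is F \<gamma> v on block \<open>b\<close>. There \<open>p\<close> sends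
    \<open>v\<close> to \<gamma> F \<kappa>^2 \<zeta>, the added columns supply \<gamma> F \<tau>^2
    \<zeta>, and the total is \<gamma> F \<zeta> = \<gamma>^2 v.\<close>
  define \<zeta> where "\<zeta> l = (\<Sum>j<r. \<gamma> b j * (F j l * v (b, j)))" for l
  let ?u = "\<lambda>l. blk b (\<lambda>j. \<gamma> b j * F j l)"
  have "(\<lambda>x. (if fst x = b then \<Sum>y\<in>I. p x y * v y else 0) +
      (\<Sum>l\<in>N. (\<tau> l * \<tau> l * \<zeta> l) * ?u l x)) \<in> R"
    using b v by (intro add sum_mem finite_N scale column_mem base_mem Q P) auto
  then show ?thesis
  proof (rule cong)
    fix x assume x: "x \<in> I"
    show "(if fst x = b then \<Sum>y\<in>I. p x y * v y else 0) +
      (\<Sum>l\<in>N. (\<tau> l * \<tau> l * \<zeta> l) * ?u l x) = \<gamma> (fst x) (snd x) * \<gamma> (fst x) (snd x) * v x"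
    proof (cases "fst x = b")
      case True
      then obtain j where xj: "x = (b, j)" by (cases x) auto
      then have j: "j < r" using x b by (auto simp: I_def C_def)
      have "(\<Sum>y\<in>I. p x y * v y) = (\<Sum>k\<in>C b. p x (b, k) * v (b, k))"
        using b v(2) by (auto simp: sum_I)
      also have "\<dots> = (\<Sum>k\<in>C b. \<gamma> b k * (\<Sum>l<r. \<gamma> b j * F j l * \<kappa> l * \<kappa> l * (F k l * v (b, k))))"
        using b by (auto simp: xj p_def T_def sum_distrib_left sum_distrib_right mult_ac intro!: sum.cong)
      also have "\<dots> = (\<Sum>k<r. \<gamma> b k * (\<Sum>l<r. \<gamma> b j * F j l * \<kappa> l * \<kappa> l * (F k l * v (b, k))))"
        by (rule sum_C)
      also have "\<dots> = (\<Sum>l<r. \<gamma> b j * F j l * (\<kappa> l * \<kappa> l) * \<zeta> l)"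
        unfolding \<zeta>_def sum_distrib_left by (subst sum.swap) (simp add: mult_ac)
      finally have 1: "(\<Sum>y\<in>I. p x y * v y) = (\<Sum>l<r. \<gamma> b j * F j l * (\<kappa> l * \<kappa> l) * \<zeta> l)" .
      have "(\<Sum>l\<in>N. (\<tau> l * \<tau> l * \<zeta> l) * ?u l x) = (\<Sum>l\<in>N. \<tau> l * (\<tau> l * \<zeta> l * ?u l x))"
        by (simp add: mult_ac)
      also have "\<dots> = (\<Sum>l<r. \<tau> l * (\<tau> l * \<zeta> l * ?u l x))"
        by (rule sum_N)
      also have "\<dots> = (\<Sum>l<r. \<gamma> b j * F j l * (\<tau> l * \<tau> l) * \<zeta> l)"
        by (simp add: xj blk_def mult_ac)
      finally have 2: "(\<Sum>l\<in>N. (\<tau> l * \<tau> l * \<zeta> l) * ?u l x) =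
        (\<Sum>l<r. \<gamma> b j * F j l * (\<tau> l * \<tau> l) * \<zeta> l)" .
      have "(\<Sum>y\<in>I. p x y * v y) + (\<Sum>l\<in>N. (\<tau> l * \<tau> l * \<zeta> l) * ?u l x) =
          (\<Sum>l<r. \<gamma> b j * F j l * (\<tau> l * \<tau> l + \<kappa> l * \<kappa> l) * \<zeta> l)"
        unfolding 1 2 sum.distrib[symmetric] by (intro sum.cong refl) (simp add: algebra_simps)
      also have "\<dots> = (\<Sum>l<r. \<gamma> b j * F j l * \<zeta> l)"
        by (simp add: \<tau>\<kappa>)
      also have "\<dots> = (\<Sum>k<r. \<gamma> b j * \<gamma> b k * v (b, k) * (\<Sum>l<r. F j l * F k l))"
        unfolding \<zeta>_def sum_distrib_left by (subst sum.swap) (simp add: mult_ac)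
      also have "\<dots> = (\<Sum>k<r. \<gamma> b j * \<gamma> b k * v (b, k) * delta j k)"
        by (simp add: F_orth j)
      also have "\<dots> = \<gamma> b j * \<gamma> b j * v (b, j)"
        using j by simp
      finally show ?thesis using True by (simp add: xj)
    qed (use v(2) in \<open>simp add: blk_def\<close>)
  qed
qed

text \<open>\<open>weight_mem\<close> permits multiplication by the weights only for vectors
  supported in block \<open>b\<close>; this is the predicate \<open>P\<close> passed to
  \<open>multiplier_mem\<close>.\<close>

lemma weight_calculus:
  assumes b: "b \<in> {1, 2}" and i: "i \<in> N"
  shows "blk b (\<lambda>j. h (\<gamma> b j * \<gamma> b j) * \<gamma> b j * F j i) \<in> R"
proof -
  let ?u = "blk b (\<lambda>j. \<gamma> b j * F j i)"
  have "(\<lambda>x. h (\<gamma> (fst x) (snd x) * \<gamma> (fst x) (snd x)) * ?u x) \<in> R"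
  proof (rule multiplier_mem[where P = "\<lambda>v. \<forall>x. fst x \<noteq> b \<longrightarrow> v x = 0"
        and f = "\<lambda>x. \<gamma> (fst x) (snd x) * \<gamma> (fst x) (snd x)"])
    show "?u \<in> R" by (intro column_mem base_mem b i)
  qed (use weight_mem[OF b] in \<open>auto simp: blk_def\<close>)
  then show ?thesis
    by (rule cong) (auto simp: blk_def mult.assoc)
qed

text \<open>In blocks 1 and 2, a coordinate of simple weight is cut out of a column by the indicator
  of that weight. Coordinates of the possibly repeated weight 1 come from a combination of two
  columns.\<close>

lemma all_mem_R: "v \<in> R"
proof (rule all_mem)
  fix x assume "x \<in> I"
  then consider i where "x = (0, i)" "i \<in> N"
    | b j where "x = (b, j)" "b \<in> {1, 2}" "j < r" "\<gamma> b j \<noteq> 0"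
    by (auto simp: I_def C_def)
  then show "delta x \<in> R"
  proof cases
    case (2 b j)
    let ?g = "\<lambda>k. \<gamma> b k * \<gamma> b k"
    have blk_delta: "delta x \<in> R" if "(\<lambda>y. c * blk b (\<lambda>k. delta j k) y) \<in> R" "c \<noteq> 0" for c
      using scaleD[OF that] by (rule cong) (auto simp: blk_def delta_def 2)
    show ?thesis
    proof (cases "\<forall>k<r. ?g k = ?g j \<longrightarrow> k = j")
      case True
      obtain i where i: "i \<in> N" "F j i \<noteq> 0" using F_row[OF 2(3)] by (auto simp: F_def)
      show ?thesis
      proof (rule blk_delta)
        show "(\<lambda>y. (\<gamma> b j * F j i) * blk b (\<lambda>k. delta j k) y) \<in> R"
          by (rule cong[OF weight_calculus[OF 2(2) i(1), of "\<lambda>z. of_bool (z = ?g j)"]])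
            (use True 2 in \<open>auto simp: blk_def delta_def I_def C_def\<close>)
      qed (use i 2 in auto)
    next
      case False
      then have g: "?g j = 1" and sub: "\<And>k. k < r \<Longrightarrow> ?g k = 1 \<Longrightarrow> k \<in> N"
        using \<gamma>_cases[OF 2(2-4)] by auto
      \<comment> \<open>The part of column \<open>i\<close> of \<gamma> F carried by the positions
        of weight 1.\<close>
      define y where "y i = blk b (\<lambda>k. of_bool (?g k = 1) * \<gamma> b k * F k i)" for i
      have yR: "y i \<in> R" if "i \<in> N" for i
        unfolding y_def by (rule weight_calculus[OF 2(2) that])
      obtain i where i: "i \<in> N" "?g i \<noteq> 1" using \<gamma>_ne_1[OF 2(2)] by blast
      have jN: "j \<in> N" using sub 2 g by auto
      have ir: "i < r" using i N_sub by auto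
      \<comment> \<open>Since \<open>F = 1 - 2 w w\<^sup>T\<close>, a column outside the eigenvalue 1 only shows the vector \<open>w\<close>.\<close>
      have "(\<lambda>x. y j x - (w j / w i) * y i x) \<in> R"
        by (intro diff scale yR jN i)
      then have "(\<lambda>x. \<gamma> b j * blk b (\<lambda>k. delta j k) x) \<in> R"
        by (rule cong) (use i g w_nz[OF ir] in
            \<open>auto simp: y_def blk_def delta_def F_def I_def C_def field_simps\<close>)
      then show ?thesis by (rule blk_delta) (use 2 in simp)
    qed
  qed (use base_mem in auto)
qed

end

locale linked_algebra = linked_projection + function_algebra I S for S +
  assumes p_mem: "p \<in> S" and q_mem: "\<And>b. b \<in> {0, 1, 2} \<Longrightarrow> diag_fun (\<lambda>x. of_bool (fst x = b)) \<in> S"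
begin

text \<open>Cutting \<open>p\<close> down to block 0 leaves the diagonal of \<tau>^2, whose entries
  are distinct on \<open>N\<close>. They are nonzero as well, so the indicator of one entry does not
  pick up the zeros on the other blocks.\<close>

lemma unit_mem:
  assumes i: "i \<in> N" shows "diag_fun (delta (0, i)) \<in> S"
proof -
  let ?q = "\<lambda>x :: nat \<times> nat. of_bool (fst x = 0) :: complex"
  let ?f = "\<lambda>x. ?q x * (\<tau> (snd x) * \<tau> (snd x))"
  have "(\<lambda>x y. (?q x * p x y) * ?q y) \<in> S"
    by (intro mult_diag_left mult_diag_right p_mem q_mem) auto
  then have "diag_fun ?f \<in> S"
    by (rule cong) (auto simp: I_def diag_fun_def p_0 T_def)
  then have "diag_fun (\<lambda>x. of_bool (?f x = \<tau> i * \<tau> i)) \<in> S"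
    by (rule diag_calculus[where h = "\<lambda>z. of_bool (z = \<tau> i * \<tau> i)"])
  then show ?thesis
    by (rule cong) (use i \<tau>_nz inj_onD[OF \<tau>_inj] in \<open>auto simp: I_def diag_fun_def delta_def split: if_splits\<close>)
qed

text \<open>For a base index \<open>i\<close> in \<open>N\<close>, the columns and the rows at
  \<open>(0, i)\<close> both form a \<open>linked_module\<close>, hence contain all vectors;
  \<open>all_mem\<close> then yields all matrices.\<close>

lemma all_mem_S: "g \<in> S"
proof -
  obtain i where i: "i \<in> N" using N_ne by blast
  interpret col: function_space I "{v. (\<lambda>x y. v x * delta (0, i) y) \<in> S}"
    by (rule function_space_col)
  interpret row: function_space I "{v. (\<lambda>x y. delta (0, i) x * v y) \<in> S}"
    by (rule function_space_row)
  have start: "(\<lambda>x y. delta (0, i) x * delta (0, i) y) \<in> S"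
    using unit_mem[OF i] by (rule cong) (auto simp: diag_fun_def delta_def)
  interpret col: linked_module r N \<gamma> \<tau> \<kappa> w "{v. (\<lambda>x y. v x * delta (0, i) y) \<in> S}"
  proof (unfold_locales, goal_cases)
    case (1 v)
    then have "(\<lambda>x y. \<Sum>z\<in>I. p x z * (v z * delta (0, i) y)) \<in> S" by (intro mult p_mem) auto
    then show ?case by (simp add: sum_distrib_right mult.assoc)
  next
    case (2 b v)
    then have "(\<lambda>x y. of_bool (fst x = b) * (v x * delta (0, i) y)) \<in> S"
      by (intro mult_diag_left[OF q_mem]) auto
    then show ?case unfolding mem_Collect_eq by (rule cong) auto
  next
    case (3 k v)
    then have "(\<lambda>x y. delta (0, k) x * (v x * delta (0, i) y)) \<in> S"
      by (intro mult_diag_left[OF unit_mem]) auto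
    then show ?case by (simp add: mult.assoc)
  qed (use start i in auto)
  interpret row: linked_module r N \<gamma> \<tau> \<kappa> w "{v. (\<lambda>x y. delta (0, i) x * v y) \<in> S}"
  proof (unfold_locales, goal_cases)
    case (1 v)
    then have "(\<lambda>x y. \<Sum>z\<in>I. delta (0, i) x * v z * p z y) \<in> S" by (intro mult p_mem) auto
    then show ?case by (simp add: sum_distrib_left mult_ac p_sym)
  next
    case (2 b v)
    then have "(\<lambda>x y. delta (0, i) x * v y * of_bool (fst y = b)) \<in> S"
      by (intro mult_diag_right[OF q_mem]) auto
    then show ?case unfolding mem_Collect_eq by (rule cong) auto
  next
    case (3 k v)
    then have "(\<lambda>x y. delta (0, i) x * v y * delta (0, k) y) \<in> S"
      by (intro mult_diag_right[OF unit_mem]) auto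
    then show ?case by (simp add: mult_ac)
  qed (use start i in auto)
  show ?thesis
  proof (rule all_mem)
    show "(0, i) \<in> I" using i by (simp add: I_def)
  qed (use col.all_mem_R row.all_mem_R in auto)
qed

end

section \<open>Choice of the parameters\<close>

text \<open>Uniform weights are shifted towards an index \<open>m\<close> where \<open>d m\<close>
  differs from the plain mean \<open>a\<close>. The weighted mean \<open>a + t * (d m - a)\<close>
  then takes infinitely many values, so it leaves the finite set \<open>B\<close>.\<close>

lemma exists_weights_avoiding:
  fixes d :: "nat \<Rightarrow> real"
  assumes B: "finite B" and d: "i < r" "k < r" "d i \<noteq> d k"
  shows "\<exists>\<omega>. (\<forall>j<r. \<omega> j > 0) \<and> (\<Sum>j<r. \<omega> j) = 1 \<and> (\<Sum>j<r. \<omega> j * d j) \<notin> B"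
proof -
  define a where "a = (\<Sum>j<r. d j) / r"
  obtain m where m: "m < r" "d m \<noteq> a" using d by metis
  have r: "real r > 0" using d by simp
  have "inj_on (\<lambda>t. a + t * (d m - a)) {0<..<1::real}"
    using m by (auto simp: inj_on_def)
  then have "infinite ((\<lambda>t. a + t * (d m - a)) ` {0<..<1::real})"
    by (simp add: finite_image_iff)
  then have "\<not> (\<lambda>t. a + t * (d m - a)) ` {0<..<1::real} \<subseteq> B"
    using B finite_subset by blast
  then obtain t where t: "0 < t" "t < 1" "a + t * (d m - a) \<notin> B"
    unfolding image_subset_iff greaterThanLessThan_iff Ball_def by blast
  let ?\<omega> = "\<lambda>j. (1 - t) / r + (if j = m then t else 0)"
  have "(\<Sum>j<r. ?\<omega> j * d j) = (1 - t) / r * (\<Sum>j<r. d j) + t * d m"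
    using m by (simp add: distrib_right sum.distrib sum_distrib_left if_distrib[of "\<lambda>x. x * _"] cong: if_cong)
  also have "\<dots> = a + t * (d m - a)"
    by (simp add: a_def algebra_simps diff_divide_distrib)
  finally have "(\<Sum>j<r. ?\<omega> j * d j) \<notin> B" using t by simp
  moreover have "(\<Sum>j<r. ?\<omega> j) = 1" using m r by (simp add: sum.distrib)
  moreover have "?\<omega> j > 0" for j
    using t r by (intro add_pos_nonneg) (simp_all add: divide_pos_pos)
  ultimately show ?thesis by (intro exI[of _ ?\<omega>] conjI allI impI)
qed

lemma linked_projection_exists:
  assumes p: "1 \<le> p2" "1 \<le> p3" "p2 \<le> p1" "p3 \<le> p1" "p1 \<le> r" "2 * r \<le> p1 + p2 + p3"
  shows "\<exists>N (\<gamma> :: nat \<Rightarrow> nat \<Rightarrow> real) (\<tau> :: nat \<Rightarrow> real) (\<kappa> :: nat \<Rightarrow> real) (w :: nat \<Rightarrow> real).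
    linked_projection r N (\<lambda>b j. complex_of_real (\<gamma> b j)) (\<lambda>l. complex_of_real (\<tau> l))
      (\<lambda>l. complex_of_real (\<kappa> l)) (\<lambda>j. complex_of_real (w j)) \<and>
    card N = p1 \<and> card {j. j < r \<and> \<gamma> 1 j \<noteq> 0} = p2 \<and> card {j. j < r \<and> \<gamma> 2 j \<noteq> 0} = p3"
proof -
  \<comment> \<open>Distinct values in (0, 1), used both for \<tau>^2 and for the generic part of
    \<gamma>1^2.\<close>
  define g :: "nat \<Rightarrow> real" where "g j = (real j + 1) / (real r + 1)" for j
  \<comment> \<open>\<open>d\<close> is \<gamma>1^2 and \<open>1 - d\<close> is \<gamma>2^2. Exactly
    \<open>p2\<close> entries differ from 0 and exactly \<open>p3\<close> differ from 1.\<close>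
  define d where "d j = (if j < r - p3 then 1 else if j < p2 then g j else 0)" for j
  \<comment> \<open>The \<open>r - p1\<close> positions left out of \<open>N\<close>, placed where
    \<open>d\<close> is strictly between 0 and 1. They fit below \<open>p2\<close> because
    \<open>2 * r \<le> p1 + p2 + p3\<close>.\<close>
  define K where "K = {r - p3..<r - p3 + (r - p1)}"
  define N where "N = {..<r} - K"
  have g: "0 < g j" "j < r \<Longrightarrow> g j < 1" "g j = g k \<longleftrightarrow> j = k" for j k
    by (auto simp: g_def divide_simps)
  have d01: "0 \<le> d j" "j < r \<Longrightarrow> d j \<le> 1" for j
    using g(1)[of j] g(2)[of j] by (auto simp: d_def)
  have d_eq_1: "d j = 1 \<longleftrightarrow> j < r - p3" if "j < r" for j
    using g(2)[OF that] by (auto simp: d_def)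
  have d_eq_0: "d j = 0 \<longleftrightarrow> \<not> j < p2" for j
    using g(1)[of j] p by (auto simp: d_def)
  have K: "K \<subseteq> {r - p3..<p2}" "K \<subseteq> {..<r}" using p by (auto simp: K_def)
  have cardN: "card N = p1"
    using K(2) p by (simp add: N_def card_Diff_subset finite_subset[OF K(2)]) (simp add: K_def)
  \<comment> \<open>\<open>\<omega>\<close> will be the square of \<open>w\<close>. An off-diagonal
    entry of F d F is \<open>2 * w i * w k\<close> times the difference of the two sides of the last
    condition, so the weighted mean of \<open>d\<close> has to miss all midpoints; for
    \<open>r = 1\<close> there are none to miss.\<close>
  obtain \<omega> where \<omega>: "\<And>j. j < r \<Longrightarrow> \<omega> j > 0" "(\<Sum>j<r. \<omega> j) = 1"
    "\<And>i k. i < r \<Longrightarrow> k < r \<Longrightarrow> i \<noteq> k \<Longrightarrow> 2 * (\<Sum>j<r. \<omega> j * d j) \<noteq> d i + d k"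
  proof (cases "r = 1")
    case True
    then show ?thesis by (intro that[of "\<lambda>_. 1"]) auto
  next
    case False
    then have r: "r \<ge> 2" using p by auto
    \<comment> \<open>\<open>exists_weights_avoiding\<close> asks for two different values of
      \<open>d\<close>; the first and the last position provide them.\<close>
    have "d 0 \<noteq> d (r - 1)"
    proof (cases "p3 = r")
      case True
      then have "d 0 = g 0" "d (r - 1) = g (r - 1) \<or> d (r - 1) = 0"
        using p by (auto simp: d_def)
      then show ?thesis using g(1)[of 0] g(3)[of 0 "r - 1"] r by auto
    next
      case False
      then have "d 0 = 1" "d (r - 1) \<noteq> 1"
        using p d_eq_1[of 0] d_eq_1[of "r - 1"] r by auto
      then show ?thesis by simp
    qed
    then have "\<exists>\<omega>. (\<forall>j<r. \<omega> j > 0) \<and> (\<Sum>j<r. \<omega> j) = 1 \<and>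
        (\<Sum>j<r. \<omega> j * d j) \<notin> (\<lambda>(i, k). (d i + d k) / 2) ` ({..<r} \<times> {..<r})"
      using r by (intro exists_weights_avoiding[of _ 0 r "r - 1"]) auto
    then obtain \<omega> where "\<forall>j<r. \<omega> j > 0" "(\<Sum>j<r. \<omega> j) = 1"
      "(\<Sum>j<r. \<omega> j * d j) \<notin> (\<lambda>(i, k). (d i + d k) / 2) ` ({..<r} \<times> {..<r})"
      by blast
    then show ?thesis by (intro that[of \<omega>]) (auto simp: image_iff field_simps)
  qed
  define w where "w j = sqrt (\<omega> j)" for j
  have w: "w j * w j = \<omega> j" "w j > 0" if "j < r" for j
    using \<omega>(1)[OF that] by (simp_all add: w_def)
  define \<gamma> :: "nat \<Rightarrow> nat \<Rightarrow> real" where "\<gamma> b j = (if b = 1 then sqrt (d j) else sqrt (1 - d j))" for b j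
  have \<gamma>: "\<gamma> 1 j * \<gamma> 1 j = d j" "\<gamma> 2 j * \<gamma> 2 j = 1 - d j" if "j < r" for j
    using d01[of j] that by (simp_all add: \<gamma>_def)
  define \<tau> where "\<tau> l = (if l \<in> N then sqrt (g l) else 0)" for l
  have \<tau>: "\<tau> l * \<tau> l = (if l \<in> N then g l else 0)" for l
    using g(1)[of l] by (simp add: \<tau>_def)
  define \<kappa> where "\<kappa> l = sqrt (1 - \<tau> l * \<tau> l)" for l
  have \<kappa>: "\<kappa> l * \<kappa> l = 1 - \<tau> l * \<tau> l" "\<kappa> l > 0" if "l < r" for l
    using g(2)[OF that] by (simp_all add: \<kappa>_def \<tau>)
  have link: "(\<Sum>j<r. d j * (of_bool (i = j) - 2 * w j * w i) * (of_bool (k = j) - 2 * w j * w k)) \<noteq> 0"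
    if ik: "i < r" "k < r" "i \<noteq> k" for i k
  proof -
    have "(\<Sum>j<r. d j * (of_bool (i = j) - 2 * w j * w i) * (of_bool (k = j) - 2 * w j * w k)) =
      (\<Sum>j<r. (if j = i then - 2 * w k * w i * d i else 0) +
        (if j = k then - 2 * w i * w k * d k else 0) + 4 * w i * w k * (\<omega> j * d j))"
      using ik by (intro sum.cong refl) (auto simp: algebra_simps w(1)[symmetric])
    also have "\<dots> = 2 * w i * w k * (2 * (\<Sum>j<r. \<omega> j * d j) - (d i + d k))"
      using ik by (simp add: sum.distrib sum_distrib_left algebra_simps)
    finally show ?thesis
      using \<omega>(3)[OF ik] w(2)[of i] w(2)[of k] ik by simp
  qed
  have delta: "delta i j = complex_of_real (of_bool (i = j))" for i j :: nat
    by (auto simp: delta_def)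
  have "linked_projection r N (\<lambda>b j. complex_of_real (\<gamma> b j)) (\<lambda>l. complex_of_real (\<tau> l))
      (\<lambda>l. complex_of_real (\<kappa> l)) (\<lambda>j. complex_of_real (w j))"
  proof (unfold_locales, goal_cases)
    case 1 show ?case by (auto simp: N_def)
  next
    case 2 show ?case using cardN p by auto
  next
    case 3
    have "(\<Sum>j<r. w j * w j) = 1" using w \<omega>(2) by simp
    then show ?case by (metis (mono_tags, lifting) of_real_1 of_real_mult of_real_sum sum.cong)
  next
    case (4 j) then show ?case using w(2) by force
  next
    case (5 l) then show ?case by (simp add: \<tau>_def)
  next
    case (6 l) then show ?case using g(1)[of l] by (simp add: \<tau>_def)
  next
    case 7
    show ?case by (auto simp: inj_on_def of_real_mult[symmetric] \<tau> g(3) simp del: of_real_mult)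
  next
    case (8 l)
    have "\<tau> l * \<tau> l + \<kappa> l * \<kappa> l = 1" using \<kappa>(1)[OF 8] by simp
    then show ?case by (metis of_real_1 of_real_add of_real_mult)
  next
    case (9 l) then show ?case using \<kappa>(2) by force
  next
    case (10 j)
    have "\<gamma> 1 j * \<gamma> 1 j + \<gamma> 2 j * \<gamma> 2 j = 1" using \<gamma>[OF 10] by simp
    then show ?case by (metis of_real_1 of_real_add of_real_mult)
  next
    \<comment> \<open>Weight 1 occurs for \<open>b = 1\<close> on the positions below
      \<open>r - p3\<close> and for \<open>b = 2\<close> on those from \<open>p2\<close> on; neither
      range meets \<open>K\<close>, so both lie in \<open>N\<close>. All other nonzero weights are
      simple.\<close>
    case (11 b j)
    have *: "complex_of_real x * complex_of_real x = complex_of_real y * complex_of_real y \<longleftrightarrow> x * x = y * y"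
      "complex_of_real x * complex_of_real x = 1 \<longleftrightarrow> x * x = 1" for x y
      by (metis of_real_eq_iff of_real_mult, metis of_real_1 of_real_eq_iff of_real_mult)
    have inj: "\<forall>k<r. d k = d j \<longrightarrow> k = j" if "\<not> j < r - p3" "j < p2"
    proof (intro allI impI)
      fix k assume k: "k < r" "d k = d j"
      have "d j \<noteq> 1" "d j \<noteq> 0" using that d_eq_0 d_eq_1[of j] 11 by auto
      then have "\<not> k < r - p3" "k < p2" using k d_eq_0[of k] d_eq_1[of k] by auto
      then show "k = j" using k(2) that g(3) by (simp add: d_def)
    qed
    have N: "k \<in> N" if "k < r" "k < r - p3 \<or> \<not> k < p2" for k
      using that K(1) by (auto simp: N_def)
    consider "b = 1" | "b = 2" using 11 by auto
    then show ?case
    proof cases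
      case 1
      then have "\<gamma> b k * \<gamma> b k = d k" if "k < r" for k using \<gamma> that by simp
      moreover have "d j \<noteq> 0" using 11 1 by (auto simp: \<gamma>_def)
      ultimately show ?thesis
        unfolding * using inj N 11 d_eq_0 d_eq_1 by (cases "j < r - p3") auto
    next
      case 2
      then have "\<gamma> b k * \<gamma> b k = 1 - d k" if "k < r" for k using \<gamma> that by simp
      moreover have "d j \<noteq> 1" using 11 2 by (auto simp: \<gamma>_def)
      ultimately show ?thesis
        unfolding * using inj N 11 d_eq_0 d_eq_1 by (cases "j < p2") auto
    qed
  next
    \<comment> \<open>If \<open>N\<close> had only weight 1 in block 1, it could contain no position
      from \<open>p2\<close> on. These positions do lie in \<open>N\<close>, so
      \<open>p2 = r\<close> and \<open>card N = p1 = r\<close>, against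
      \<open>card N \<le> r - p3\<close>. Block 2 is symmetric.\<close>
    case (12 b)
    have *: "complex_of_real x * complex_of_real x = 1 \<longleftrightarrow> x * x = 1" for x
      by (metis of_real_1 of_real_eq_iff of_real_mult)
    have "\<exists>i\<in>N. \<gamma> b i * \<gamma> b i \<noteq> 1"
    proof (rule ccontr)
      assume c: "\<not> (\<exists>i\<in>N. \<gamma> b i * \<gamma> b i \<noteq> 1)"
      consider "b = 1" | "b = 2" using 12 by auto
      then show False
      proof cases
        case 1
        have "i \<in> {..<r - p3}" if "i \<in> N" for i
        proof -
          have "i < r" using that by (simp add: N_def)
          moreover have "\<gamma> 1 i * \<gamma> 1 i = 1" using c 1 that by blast
          ultimately have "d i = 1" using \<gamma>(1) by auto
          then show ?thesis using \<open>i < r\<close> d_eq_1[of i] by simp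
        qed
        then have "N \<subseteq> {..<r - p3}" by blast
        moreover have "{p2..<r} \<subseteq> N" using K(1) by (auto simp: N_def)
        ultimately have "{p2..<r} \<subseteq> {..<r - p3}" "card N \<le> r - p3"
          using card_mono[of "{..<r - p3}" N] by auto
        then show False using p cardN by (cases "p2 < r") (auto simp: subset_iff)
      next
        case 2
        have "i \<in> {p2..<r}" if "i \<in> N" for i
        proof -
          have "i < r" using that by (simp add: N_def)
          moreover have "\<gamma> 2 i * \<gamma> 2 i = 1" using c 2 that by blast
          ultimately have "d i = 0" using \<gamma>(2) by auto
          then show ?thesis using \<open>i < r\<close> d_eq_0[of i] by simp
        qed
        then have "N \<subseteq> {p2..<r}" by blast
        moreover have "{..<r - p3} \<subseteq> N" using K(1) by (auto simp: N_def)
        ultimately have "{..<r - p3} \<subseteq> {p2..<r}" "card N \<le> r - p2"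
          using card_mono[of "{p2..<r}" N] by auto
        then show False using p cardN by (cases "p3 < r") (auto simp: subset_iff)
      qed
    qed
    then show ?case by (simp add: *)
  next
    \<comment> \<open>An index \<open>i\<close> of \<open>N\<close> other than \<open>j\<close>
      gives the entry \<open>- 2 * w j * w i\<close>. Otherwise \<open>p1 = 1\<close>, which forces
      \<open>r = 1\<close>, and the only entry is 1 - 2 = -1.\<close>
    case (13 j)
    show ?case
    proof (cases "\<exists>i\<in>N. i \<noteq> j")
      case True
      then obtain i where i: "i \<in> N" "i \<noteq> j" by blast
      then have "i < r" by (simp add: N_def)
      then have "w i \<noteq> 0" "w j \<noteq> 0" using w(2)[of i] w(2)[of j] 13 by auto
      then have "delta j i - 2 * complex_of_real (w j) * complex_of_real (w i) \<noteq> 0"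
        using i(2) by (simp add: delta_def)
      with i(1) show ?thesis by blast
    next
      case False
      then have "N \<subseteq> {j}" by auto
      then have "p1 \<le> 1" using cardN card_mono[of "{j}" N] by simp
      then have r: "r = 1" using p by auto
      then have j: "j = 0" "w 0 * w 0 = 1" using 13 \<omega>(2) w(1)[of 0] by simp_all
      then have "complex_of_real (w 0) * complex_of_real (w 0) = 1"
        by (metis of_real_1 of_real_mult)
      moreover have "card N \<noteq> 0" using cardN p by simp
      then have "N \<noteq> {}" by auto
      moreover have "N \<subseteq> {0}" using r by (auto simp: N_def)
      ultimately have "0 \<in> N" by blast
      with \<open>complex_of_real (w 0) * complex_of_real (w 0) = 1\<close> show ?thesis by (intro bexI[of _ 0]) (simp_all add: mult.assoc j)
    qed
  next
    case (14 i k)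
    then have ik: "i < r" "k < r" "i \<noteq> k" by (auto simp: N_def)
    have "(\<Sum>j<r. complex_of_real (\<gamma> 1 j) * complex_of_real (\<gamma> 1 j) *
        (delta j i - 2 * complex_of_real (w j) * complex_of_real (w i)) *
        (delta j k - 2 * complex_of_real (w j) * complex_of_real (w k))) =
      complex_of_real (\<Sum>j<r. d j * (of_bool (i = j) - 2 * w j * w i) * (of_bool (k = j) - 2 * w j * w k))"
      unfolding of_real_sum
    proof (intro sum.cong refl)
      fix j assume "j \<in> {..<r}"
      then have "\<gamma> 1 j * \<gamma> 1 j = d j" by (intro \<gamma>(1)) simp
      then show "complex_of_real (\<gamma> 1 j) * complex_of_real (\<gamma> 1 j) *
          (delta j i - 2 * complex_of_real (w j) * complex_of_real (w i)) *
          (delta j k - 2 * complex_of_real (w j) * complex_of_real (w k)) =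
        complex_of_real (d j * (of_bool (i = j) - 2 * w j * w i) * (of_bool (k = j) - 2 * w j * w k))"
        by (simp only: of_real_mult[symmetric]) (simp add: delta_def)
    qed
    also have "\<dots> \<noteq> 0" using link[OF ik] by (simp only: of_real_eq_0_iff not_False_eq_True)
    finally show ?case .
  qed
  moreover have "{j. j < r \<and> \<gamma> 1 j \<noteq> 0} = {..<p2}" "{j. j < r \<and> \<gamma> 2 j \<noteq> 0} = {r - p3..<r}"
    using d_eq_0 d_eq_1 p by (auto simp: \<gamma>_def)
  ultimately show ?thesis
    using cardN p by (intro exI[of _ N] exI[of _ \<gamma>] exI[of _ \<tau>] exI[of _ \<kappa>] exI[of _ w]) simp
qed

section \<open>Generating pairs\<close>

text \<open>The hull is the intersection of all subalgebras above \<open>X\<close>; the full matrix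
  algebra is one of them and keeps the hull inside \<open>carrier_mat n n\<close>.\<close>

lemma is_subalgebra_generated_algebra:
  assumes "X \<subseteq> carrier_mat n n"
  shows "is_subalgebra n (generated_algebra n X)"
proof -
  have carrier: "is_subalgebra n (carrier_mat n n)"
    by (auto simp: is_subalgebra_def intro: mult_carrier_mat)
  have mem: "M \<in> generated_algebra n X \<longleftrightarrow> (\<forall>S. is_subalgebra n S \<and> X \<subseteq> S \<longrightarrow> M \<in> S)" for M
    by (auto simp: generated_algebra_def hull_def)
  show ?thesis
    unfolding is_subalgebra_def[of n "generated_algebra n X"]
  proof (intro conjI ballI allI subsetI)
    fix M assume "M \<in> generated_algebra n X"
    then show "M \<in> carrier_mat n n" using carrier assms by (simp add: mem)
  next
    show "1\<^sub>m n \<in> generated_algebra n X" by (simp add: mem is_subalgebra_def)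
  next
    fix M M' assume M: "M \<in> generated_algebra n X" "M' \<in> generated_algebra n X"
    have "M + M' \<in> S \<and> M * M' \<in> S" if "is_subalgebra n S" "X \<subseteq> S" for S
      using that M[unfolded mem, rule_format, of S] by (simp add: is_subalgebra_def)
    then show "M + M' \<in> generated_algebra n X" "M * M' \<in> generated_algebra n X"
      by (simp_all add: mem)
  next
    fix c M assume M: "M \<in> generated_algebra n X"
    have "c \<cdot>\<^sub>m M \<in> S" if "is_subalgebra n S" "X \<subseteq> S" for S
      using that M[unfolded mem, rule_format, of S] by (simp add: is_subalgebra_def)
    then show "c \<cdot>\<^sub>m M \<in> generated_algebra n X" by (simp add: mem)
  qed
qed

lemma subset_generated_algebra: "X \<subseteq> generated_algebra n X"
  by (simp add: generated_algebra_def hull_subset)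

lemma unitary_diagonalized_values:
  assumes A: "diagonalized n A W d" and U: "unitary_mat n A" and i: "i < n"
  shows "cnj (d i) * d i = 1"
proof -
  have W: "unitary_mat n W" "A = mat_adjoint W * mat_diag n d * W"
    using A by (auto simp: diagonalized_def)
  have "mat_diag n d = W * A * mat_adjoint W"
    using unitary_conjugation_eq_iff[OF W(1) mat_diag_dim diagonalized_carrier[OF A]] W(2) by blast
  then have "unitary_mat n (mat_diag n d)"
    using U W(1) by (simp add: unitary_mat_mult unitary_mat_adjoint)
  then have "(mat_adjoint (mat_diag n d) * mat_diag n d) $$ (i, i) = 1"
    using i by (simp add: unitary_matD)
  then show ?thesis
    using i by (simp add: mat_diag_mult_right[OF mat_adjoint_carrier[OF mat_diag_dim]])
      (simp add: mat_diag_def)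
qed

lemma cnj_delta [simp]: "cnj (delta a x) = delta a x"
  by (simp add: delta_def)

section \<open>Orthogonal projections over an index set, as matrices\<close>

text \<open>The enumeration \<open>h\<close> turns functions of two indices into matrices. A real
  symmetric idempotent \<open>p\<close> is an orthogonal projection, and its rank is recorded by the
  trace.\<close>

locale indexed_projection =
  fixes I :: "'i set" and p :: "'i \<Rightarrow> 'i \<Rightarrow> complex" and h :: "nat \<Rightarrow> 'i" and n r :: nat
  assumes h: "bij_betw h {..<n} I"
    and p_real: "\<And>x y. cnj (p x y) = p x y"
    and p_sym: "\<And>x y. p x y = p y x"
    and p_idem: "\<And>x y. (\<Sum>z\<in>I. p x z * p z y) = p x y"
    and p_trace: "(\<Sum>x\<in>I. p x x) = of_nat r"
begin

definition mat_of :: "('i \<Rightarrow> 'i \<Rightarrow> complex) \<Rightarrow> complex mat" where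
  "mat_of f = mat n n (\<lambda>(i, j). f (h i) (h j))"

lemma mat_of_carrier [simp]: "mat_of f \<in> carrier_mat n n"
  and mat_of_dim [simp]: "dim_row (mat_of f) = n" "dim_col (mat_of f) = n"
  and mat_of_index [simp]: "i < n \<Longrightarrow> j < n \<Longrightarrow> mat_of f $$ (i, j) = f (h i) (h j)"
  by (simp_all add: mat_of_def)

lemma finite_I: "finite I"
  using bij_betw_finite[OF h] by simp

lemma h_mem: "i < n \<Longrightarrow> h i \<in> I"
  using h by (auto simp: bij_betw_def)

lemma h_eq_iff: "i < n \<Longrightarrow> j < n \<Longrightarrow> h i = h j \<longleftrightarrow> i = j"
  using h by (auto simp: bij_betw_def inj_on_def)

lemma mat_of_mult: "mat_of f * mat_of g = mat_of (\<lambda>x y. \<Sum>z\<in>I. f x z * g z y)"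
proof (rule eq_matI)
  fix i j assume "i < dim_row (mat_of (\<lambda>x y. \<Sum>z\<in>I. f x z * g z y))"
    "j < dim_col (mat_of (\<lambda>x y. \<Sum>z\<in>I. f x z * g z y))"
  then have ij: "i < n" "j < n" by auto
  show "(mat_of f * mat_of g) $$ (i, j) = mat_of (\<lambda>x y. \<Sum>z\<in>I. f x z * g z y) $$ (i, j)"
    unfolding index_mult[OF mat_of_carrier mat_of_carrier ij]
    using ij by (simp add: sum.reindex_bij_betw[OF h, of "\<lambda>z. f (h i) z * g z (h j)", symmetric])
qed auto

lemma mat_of_surj: "M \<in> carrier_mat n n \<Longrightarrow> \<exists>f. M = mat_of f"
  by (intro exI[of _ "\<lambda>x y. M $$ (inv_into {..<n} h x, inv_into {..<n} h y)"] eq_matI)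
    (use h in \<open>auto simp: bij_betw_def inv_into_f_f\<close>)

lemma mat_of_diag: "mat_of (diag_fun f) = mat_diag n (\<lambda>i. f (h i))"
  by (rule eq_matI) (auto simp: mat_diag_def diag_fun_def h_eq_iff)

text \<open>The matrix with eigenvalue \<open>a\<close> on the range of \<open>p\<close> and \<open>b\<close> on its orthogonal complement.\<close>

definition two_valued :: "complex \<Rightarrow> complex \<Rightarrow> complex mat" where
  "two_valued a b = mat_of (\<lambda>x y. b * delta x y + (a - b) * p x y)"

text \<open>The range of \<open>p\<close> and its orthogonal complement are multiplied separately,
  since \<open>p\<close> is idempotent.\<close>

lemma two_valued_mult: "two_valued a b * two_valued c d = two_valued (a * c) (b * d)"
proof -
  have "(\<Sum>z\<in>I. (b * delta x z + (a - b) * p x z) * (d * delta z y + (c - d) * p z y)) =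
      b * d * delta x y + (a * c - b * d) * p x y" if "x \<in> I" "y \<in> I" for x y
  proof -
    have "(\<Sum>z\<in>I. (b * delta x z + (a - b) * p x z) * (d * delta z y + (c - d) * p z y)) =
        (\<Sum>z\<in>I. delta x z * (b * d * delta z y) + delta x z * (b * (c - d) * p z y)
          + ((a - b) * d * p x z) * delta z y + (a - b) * (c - d) * (p x z * p z y))"
      by (intro sum.cong refl) (simp add: algebra_simps)
    also have "\<dots> = b * d * delta x y + b * (c - d) * p x y + (a - b) * d * p x y
        + (a - b) * (c - d) * p x y"
      using that finite_I by (simp only: sum.distrib sum_delta sum_distrib_left[symmetric] p_idem if_True)
    finally show ?thesis by (simp add: algebra_simps)
  qed
  then show ?thesis
    unfolding two_valued_def mat_of_mult by (intro eq_matI) (auto simp: h_mem)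
qed

lemma two_valued_carrier [simp]: "two_valued a b \<in> carrier_mat n n"
  and two_valued_dim [simp]: "dim_row (two_valued a b) = n" "dim_col (two_valued a b) = n"
  and two_valued_index: "i < n \<Longrightarrow> j < n \<Longrightarrow>
    two_valued a b $$ (i, j) = b * delta (h i) (h j) + (a - b) * p (h i) (h j)"
  by (simp_all add: two_valued_def)

lemma two_valued_one: "two_valued 1 1 = 1\<^sub>m n"
  by (rule eq_matI) (auto simp: two_valued_index delta_def h_eq_iff)

lemma two_valued_zero: "two_valued 0 0 = 0\<^sub>m n n"
  by (rule eq_matI) (auto simp: two_valued_index)

lemma two_valued_pow: "two_valued a b ^\<^sub>m k = two_valued (a ^ k) (b ^ k)"
  by (induction k) (simp_all add: two_valued_one two_valued_mult mult.commute)

lemma two_valued_poly: "poly_mat n q (two_valued a b) = two_valued (poly q a) (poly q b)"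
  by (rule eq_matI)
    (simp_all add: poly_mat_def two_valued_pow two_valued_index poly_altdef algebra_simps sum.distrib
      sum_subtractf sum_distrib_left sum_distrib_right)

lemma two_valued_adjoint: "mat_adjoint (two_valued a b) = two_valued (cnj a) (cnj b)"
  by (rule eq_matI) (auto simp: two_valued_index p_real p_sym delta_def)

lemma two_valued_unitary:
  assumes "cnj a * a = 1" "cnj b * b = 1" shows "unitary_mat n (two_valued a b)"
  by (rule unitary_matI) (simp_all add: two_valued_adjoint two_valued_mult assms two_valued_one)

lemma two_valued_trace: "(\<Sum>i<n. two_valued a b $$ (i, i)) = of_nat n * b + (a - b) * of_nat r"
proof -
  have "(\<Sum>i<n. two_valued a b $$ (i, i)) = (\<Sum>i<n. b + (a - b) * p (h i) (h i))"
    by (simp add: two_valued_def)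
  also have "\<dots> = of_nat n * b + (a - b) * (\<Sum>i<n. p (h i) (h i))"
    by (simp add: sum.distrib sum_distrib_left)
  also have "(\<Sum>i<n. p (h i) (h i)) = of_nat r"
    using sum.reindex_bij_betw[OF h, of "\<lambda>x. p x x"] p_trace by simp
  finally show ?thesis .
qed

text \<open>The quadratic polynomial with roots \<open>a\<close> and \<open>b\<close> annihilates
  the matrix, so no other eigenvalue occurs. Comparing the trace with the sum of the eigenvalues
  then fixes the multiplicity of \<open>a\<close> at \<open>r\<close>.\<close>

lemma two_valued_diagonalized:
  assumes ab: "a \<noteq> b" "cnj a * a = 1" "cnj b * b = 1"
  shows "\<exists>X e. diagonalized n (two_valued a b) X e \<and>
    (\<forall>c. card {i. i < n \<and> e i = c} = (if c = a then r else if c = b then n - r else 0))"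
proof -
  let ?q = "[:-a, 1:] * [:-b, 1:]"
  have q: "poly_mat n ?q (two_valued a b) = 0\<^sub>m n n"
    unfolding two_valued_poly by (simp add: two_valued_zero)
  obtain X e where X: "diagonalized n (two_valued a b) X e"
    using unitary_diagonalizable[OF two_valued_unitary[OF ab(2,3)] _ q] by auto
  have "\<forall>i<n. poly ?q (e i) = 0"
    using q unfolding poly_mat_diagonalized_eq_0_iff[OF X] .
  moreover have "poly ?q z = (z - a) * (z - b)" for z by (simp add: algebra_simps)
  ultimately have e: "e i = a \<or> e i = b" if "i < n" for i using that by auto
  let ?A = "{i. i < n \<and> e i = a}"
  have "(\<Sum>i<n. e i) = (\<Sum>i<n. b + (if i \<in> ?A then a - b else 0))"
    using e by (intro sum.cong refl) auto
  also have "\<dots> = of_nat n * b + (\<Sum>i<n. if i \<in> ?A then a - b else 0)"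
    by (simp only: sum.distrib sum_constant card_lessThan)
  also have "(\<Sum>i<n. if i \<in> ?A then a - b else 0) = (\<Sum>i\<in>?A. a - b)"
    by (rule sum.mono_neutral_cong_right) auto
  also have "\<dots> = (a - b) * of_nat (card ?A)" by simp
  finally have "(a - b) * of_nat (card ?A) = (a - b) * of_nat r"
    using trace_diagonalized[OF X] two_valued_trace[of a b] by (metis add_left_cancel)
  then have "card ?A = r" using ab(1) by (simp only: mult_cancel_left of_nat_eq_iff) auto
  moreover have "{i. i < n \<and> e i = b} = {..<n} - ?A" using e ab(1) by auto
  then have "card {i. i < n \<and> e i = b} = n - card ?A"
    by (simp only:) (subst card_Diff_subset; auto)
  moreover have "{i. i < n \<and> e i = c} = {}" if "c \<noteq> a" "c \<noteq> b" for c using e that by auto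
  ultimately show ?thesis using X by (intro exI[of _ X] exI[of _ e]) auto
qed

lemma function_algebra_mat_of:
  assumes "is_subalgebra n S"
  shows "function_algebra I {f. mat_of f \<in> S}"
proof (unfold_locales, goal_cases)
  case 1 show ?case by (rule finite_I)
next
  case (2 f g)
  then have "mat_of f = mat_of g" by (intro eq_matI) (auto simp: h_mem)
  with 2 show ?case by simp
next
  case (3 f g)
  have "mat_of (\<lambda>x y. f x y + g x y) = mat_of f + mat_of g" by (rule eq_matI) auto
  with 3 assms show ?case by (simp add: is_subalgebra_def)
next
  case (4 c f)
  have "mat_of (\<lambda>x y. c * f x y) = c \<cdot>\<^sub>m mat_of f" by (rule eq_matI) auto
  with 4 assms show ?case by (simp add: is_subalgebra_def)
next
  case (5 f g)
  with assms show ?case by (simp add: is_subalgebra_def mat_of_mult[symmetric])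
next
  case 6
  from assms show ?case by (simp add: is_subalgebra_def mat_of_diag)
qed

end

text \<open>\<open>A\<close> takes the value \<open>a\<close> on the range of the linking projection
  and \<open>b\<close> on its complement, while \<open>f\<close> is constant with value
  \<open>v k\<close> on block \<open>k\<close>. The generated algebra recovers the projection and
  the block projections, so \<open>linked_algebra\<close> applies.\<close>

lemma exists_generating_pair:
  assumes p: "1 \<le> p2" "1 \<le> p3" "p2 \<le> p1" "p3 \<le> p1" "p1 \<le> r" "2 * r \<le> n" "p1 + p2 + p3 = n"
    and ab: "a \<noteq> b" "cnj a * a = 1" "cnj b * b = 1"
    and v: "inj_on v {0, 1, 2 :: nat}"
  shows "\<exists>A X e f. diagonalized n A X e \<and>
    (\<forall>c. card {i. i < n \<and> e i = c} = (if c = a then r else if c = b then n - r else 0)) \<and>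
    (\<forall>c. card {i. i < n \<and> f i = c} = (if c = v 0 then p1 else if c = v 1 then p2 else if c = v 2 then p3 else 0)) \<and>
    generated_algebra n {A, mat_diag n f} = carrier_mat n n"
proof -
  obtain N and \<gamma> :: "nat \<Rightarrow> nat \<Rightarrow> real" and \<tau> \<kappa> w :: "nat \<Rightarrow> real" where
    L: "linked_projection r N (\<lambda>b j. complex_of_real (\<gamma> b j)) (\<lambda>l. complex_of_real (\<tau> l))
      (\<lambda>l. complex_of_real (\<kappa> l)) (\<lambda>j. complex_of_real (w j))"
    and card: "card N = p1" "card {j. j < r \<and> \<gamma> 1 j \<noteq> 0} = p2" "card {j. j < r \<and> \<gamma> 2 j \<noteq> 0} = p3"
    using linked_projection_exists[of p2 p3 p1 r] p by auto
  interpret L: linked_projection r N "\<lambda>b j. complex_of_real (\<gamma> b j)" "\<lambda>l. complex_of_real (\<tau> l)"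
    "\<lambda>l. complex_of_real (\<kappa> l)" "\<lambda>j. complex_of_real (w j)" by (rule L)
  have C: "card (L.C 1) = p2" "card (L.C 2) = p3" using card by (simp_all add: L.C_def)
  have "card L.I = p1 + (p2 + p3)"
    unfolding L.I_def using card(1) C L.finite_N L.finite_C
    by (subst card_Un_disjoint; (subst card_Un_disjoint)?) auto
  then obtain h where h: "bij_betw h {..<n} L.I"
    using ex_bij_betw_nat_finite[OF L.finite_I] p by (auto simp: atLeast0LessThan add.assoc)
  interpret H: indexed_projection L.I L.p h n r
  proof
    show "cnj (L.p x y) = L.p x y" for x y
      by (auto simp: L.p_def L.T_def L.F_def intro!: sum.cong)
  qed (use h L.p_sym L.p_idem L.p_trace in auto)
  obtain X e where X: "diagonalized n (H.two_valued a b) X e"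
    "\<forall>c. card {i. i < n \<and> e i = c} = (if c = a then r else if c = b then n - r else 0)"
    using H.two_valued_diagonalized[OF ab] by blast
  define f where "f i = v (fst (h i))" for i
  have fst_I: "fst x \<in> {0, 1, 2}" if "x \<in> L.I" for x using that by (auto simp: L.I_def)
  have count: "card {i. i < n \<and> f i = c} = card {x \<in> L.I. v (fst x) = c}" for c
  proof (rule bij_betw_same_card[of h])
    show "bij_betw h {i. i < n \<and> f i = c} {x \<in> L.I. v (fst x) = c}"
    proof -
      have I: "L.I = h ` {..<n}" and inj: "inj_on h {..<n}"
        using h by (auto simp: bij_betw_def)
      show ?thesis unfolding I using inj by (auto simp: bij_betw_def inj_on_def f_def)
    qed
  qed
  have blocks: "card {x \<in> L.I. fst x = k} = (if k = 0 then p1 else if k = 1 then p2 else p3)"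
    if "k \<in> {0, 1, 2}" for k
  proof -
    have "{x \<in> L.I. fst x = k} = {k} \<times> (if k = 0 then N else L.C k)"
      using that by (auto simp: L.I_def)
    then show ?thesis using that card(1) C by (auto simp: card_cartesian_product_singleton)
  qed
  have "card {i. i < n \<and> f i = c} = (if c = v 0 then p1 else if c = v 1 then p2 else if c = v 2 then p3 else 0)" for c
  proof (cases "c \<in> v ` {0, 1, 2}")
    case True
    then obtain k where k: "k \<in> {0, 1, 2}" "c = v k" by blast
    have "{x \<in> L.I. v (fst x) = c} = {x \<in> L.I. fst x = k}"
    proof (intro Collect_cong conj_cong refl)
      fix x assume "x \<in> L.I"
      then show "v (fst x) = c \<longleftrightarrow> fst x = k"
        unfolding k(2) using inj_on_eq_iff[OF v fst_I k(1)] by simp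
    qed
    then have "card {i. i < n \<and> f i = c} = (if k = 0 then p1 else if k = 1 then p2 else p3)"
      using count[of c] blocks[OF k(1)] by simp
    moreover have "v 0 \<noteq> v 1" "v 0 \<noteq> v 2" "v 1 \<noteq> v 2" using v by (auto simp: inj_on_def)
    ultimately show ?thesis using k by auto
  next
    case False
    then have "{x \<in> L.I. v (fst x) = c} = {}" using fst_I by blast
    then have "card {i. i < n \<and> f i = c} = 0" unfolding count by (simp only: card.empty)
    then show ?thesis using False by auto
  qed
  moreover have "generated_algebra n {H.two_valued a b, mat_diag n f} = carrier_mat n n"
  proof -
    let ?G = "generated_algebra n {H.two_valued a b, mat_diag n f}"
    have G: "is_subalgebra n ?G"
      by (rule is_subalgebra_generated_algebra) (auto simp: H.two_valued_def)
    have gens: "H.two_valued a b \<in> ?G" "mat_diag n f \<in> ?G"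
      using subset_generated_algebra by blast+
    interpret S: function_algebra L.I "{g. H.mat_of g \<in> ?G}"
      by (rule H.function_algebra_mat_of[OF G])
    interpret S: linked_algebra r N "\<lambda>b j. complex_of_real (\<gamma> b j)" "\<lambda>l. complex_of_real (\<tau> l)"
      "\<lambda>l. complex_of_real (\<kappa> l)" "\<lambda>j. complex_of_real (w j)" "{g. H.mat_of g \<in> ?G}"
    proof
      \<comment> \<open>The projection is recovered as (A - b)/(a - b).\<close>
      have "(\<lambda>x y. b * delta x y + (a - b) * L.p x y) \<in> {g. H.mat_of g \<in> ?G}"
        using gens(1) by (simp add: H.two_valued_def)
      from S.add[OF this S.scale[OF S.one, of "- b"]]
      have "(\<lambda>x y. (a - b) * L.p x y) \<in> {g. H.mat_of g \<in> ?G}"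
        by (rule S.cong) (auto simp: diag_fun_def delta_def)
      from S.scale[OF this, of "inverse (a - b)"]
      show "L.p \<in> {g. H.mat_of g \<in> ?G}" by (rule S.cong) (use ab(1) in simp)
    next
      fix k :: nat assume k: "k \<in> {0, 1, 2}"
      \<comment> \<open>Injectivity of \<open>v\<close> makes the indicator of the value
        \<open>v k\<close> the projection onto block \<open>k\<close>.\<close>
      have "diag_fun (\<lambda>x. v (fst x)) \<in> {g. H.mat_of g \<in> ?G}"
        using gens(2) by (simp add: H.mat_of_diag f_def[abs_def])
      then have "diag_fun (\<lambda>x. of_bool (v (fst x) = v k)) \<in> {g. H.mat_of g \<in> ?G}"
        by (rule S.diag_calculus[where h = "\<lambda>z. of_bool (z = v k)"])
      then show "diag_fun (\<lambda>x. of_bool (fst x = k)) \<in> {g. H.mat_of g \<in> ?G}"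
      proof (rule S.cong)
        fix x y assume "x \<in> L.I"
        then have "v (fst x) = v k \<longleftrightarrow> fst x = k"
          using inj_on_eq_iff[OF v fst_I k] by simp
        then show "diag_fun (\<lambda>x. of_bool (v (fst x) = v k)) x y = diag_fun (\<lambda>x. of_bool (fst x = k)) x y"
          by (auto simp: diag_fun_def)
      qed
    qed
    have "carrier_mat n n \<subseteq> ?G"
      using H.mat_of_surj S.all_mem_S by blast
    then show ?thesis using G by (auto simp: is_subalgebra_def)
  qed
  ultimately show ?thesis using X by blast
qed

section \<open>The multiplicity criterion\<close>

theorem theorem4p1:
  fixes n :: nat and U V :: "complex mat" and mU mV :: "complex poly"
  assumes "n \<ge> 3"
    and "unitary_mat n U" and "unitary_mat n V"
    and "is_minimal_poly n U mU" and "degree mU = 2"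
    and "is_minimal_poly n V mV" and "degree mV = 3"
  shows "(\<exists>U0 \<in> unitary_orbit n U. \<exists>V0 \<in> unitary_orbit n V.
            generated_algebra n {U0, V0} = carrier_mat n n)
         \<longleftrightarrow> max_mult U + max_mult V \<le> n"
proof -
  have diag: "\<exists>W d. diagonalized n A W d" if "unitary_mat n A" "is_minimal_poly n A q" for A q
    
  proof -
    have "q \<noteq> 0" "poly_mat n q A = 0\<^sub>m n n" using that(2) by (auto simp: is_minimal_poly_def)
    then show ?thesis using unitary_diagonalizable that(1) by blast
  qed
  obtain W d where U: "diagonalized n U W d" using diag assms by blast
  obtain Y g where V: "diagonalized n V Y g" using diag assms by blast
  let ?cd = "\<lambda>a. card {i. i < n \<and> d i = a}" and ?cg = "\<lambda>a. card {i. i < n \<and> g i = a}"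
  have mult: "max_mult U = Max (?cd ` d ` {..<n})" "max_mult V = Max (?cg ` g ` {..<n})"
    by (rule max_mult_diagonalized[OF U] max_mult_diagonalized[OF V])+
  have "0 \<in> {..<n}" using assms(1) by simp
  then have ne: "{..<n} \<noteq> {}" by blast
  show ?thesis
  proof
    assume "\<exists>U0 \<in> unitary_orbit n U. \<exists>V0 \<in> unitary_orbit n V.
            generated_algebra n {U0, V0} = carrier_mat n n"
    then obtain U0 V0 where 0: "U0 \<in> unitary_orbit n U" "V0 \<in> unitary_orbit n V"
      "generated_algebra n {U0, V0} = carrier_mat n n" by blast
    obtain W' where U0: "diagonalized n U0 W' d" using unitary_orbit_diagonalized[OF U 0(1)] by blast
    obtain Y' where V0: "diagonalized n V0 Y' g" using unitary_orbit_diagonalized[OF V 0(2)] by blast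
    have "max_mult U \<in> ?cd ` d ` {..<n}" "max_mult V \<in> ?cg ` g ` {..<n}"
      unfolding mult using ne by (intro Max_in; simp)+
    then obtain a b where ab: "max_mult U = ?cd a" "max_mult V = ?cg b" by blast
    show "max_mult U + max_mult V \<le> n"
    proof (rule ccontr)
      assume "\<not> ?thesis"
      then have "n < ?cd a + ?cg b" using ab by simp
      from exists_common_eigenvector[OF U0 V0 this]
      obtain x where "x \<in> carrier_vec n" "x \<noteq> 0\<^sub>v n" "U0 *\<^sub>v x = a \<cdot>\<^sub>v x" "V0 *\<^sub>v x = b \<cdot>\<^sub>v x" by blast
      then show False
        using generated_algebra_ne_if_common_eigenvector[of n U0 V0 x a b] 0(3) assms(1)
          diagonalized_carrier[OF U0] diagonalized_carrier[OF V0] by simp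
    qed
  next
    assume le: "max_mult U + max_mult V \<le> n"
    have cov: "(\<Sum>a\<in>f ` {..<n}. card {i. i < n \<and> f i = a}) = n" for f :: "nat \<Rightarrow> complex"
    proof -
      have "(\<Sum>a\<in>f ` {..<n}. card {i \<in> {..<n}. f i = a}) = card {..<n}"
        using sum.image_gen[of "{..<n}" "\<lambda>_. 1 :: nat" f] by simp
      then show ?thesis by simp
    qed
    have pos: "1 \<le> card {i. i < n \<and> f i = c}" if "c \<in> f ` {..<n}" for f :: "nat \<Rightarrow> complex" and c
      using that by (auto simp: Suc_le_eq card_gt_0_iff)
    have zero: "card {i. i < n \<and> f i = c} = 0" if "c \<notin> f ` {..<n}" for f :: "nat \<Rightarrow> complex" and c
      using that by auto
    have maxU: "max_mult U \<in> ?cd ` d ` {..<n}" "?cd c \<le> max_mult U" if "c \<in> d ` {..<n}" for c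
      unfolding mult using ne that by (intro Max_in Max_ge; simp)+
    have maxV: "max_mult V \<in> ?cg ` g ` {..<n}" "?cg c \<le> max_mult V" if "c \<in> g ` {..<n}" for c
      unfolding mult using ne that by (intro Max_in Max_ge; simp)+
    have cardU: "card (d ` {..<n}) = 2" using degree_minimal_poly_diagonalized[OF U] assms by simp
    have cardV: "card (g ` {..<n}) = 3" using degree_minimal_poly_diagonalized[OF V] assms by simp
    \<comment> \<open>\<open>b\<close> has the larger multiplicity. The other eigenvalue
      \<open>a\<close>, of multiplicity \<open>n - max_mult U\<close>, will belong to the range of
      the linking projection.\<close>
    obtain b where b: "b \<in> d ` {..<n}" "max_mult U = ?cd b" using maxU(1) ne by blast
    have "card (d ` {..<n} - {b}) = 1" using b cardU by simp
    then obtain a where "d ` {..<n} - {b} = {a}" by (auto simp: card_1_singleton_iff)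
    then have a: "d ` {..<n} = {a, b}" "a \<noteq> b" using b by auto
    \<comment> \<open>An eigenvalue of largest multiplicity is assigned to block 0.\<close>
    obtain c0 where c0: "c0 \<in> g ` {..<n}" "max_mult V = ?cg c0" using maxV(1) ne by blast
    have "card (g ` {..<n} - {c0}) = 2" using c0 cardV by simp
    then obtain c1 c2 where c: "g ` {..<n} - {c0} = {c1, c2}" "c1 \<noteq> c2" by (auto simp: card_2_iff)
    then have g: "g ` {..<n} = {c0, c1, c2}" "c0 \<noteq> c1" "c0 \<noteq> c2" using c0 by auto
    define v where "v k = (if k = 0 then c0 else if k = 1 then c1 else c2)" for k :: nat
    have sumU: "?cd a + ?cd b = n" using cov[of d] a by simp
    have sumV: "?cg c0 + ?cg c1 + ?cg c2 = n" using cov[of g] g c(2) by simp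
    have "cnj (d i) * d i = 1" if "i < n" for i
      using unitary_diagonalized_values[OF U assms(2) that] .
    then have unit: "cnj a * a = 1" "cnj b * b = 1" using a by (metis imageE insertI1 lessThan_iff, metis imageE insertI1 insert_commute lessThan_iff)
    have "?cd a \<le> ?cd b" using maxU(2)[of a] a b by auto
    \<comment> \<open>The first bound holds since \<open>a\<close> has the smaller multiplicity; the
      second is the assumption \<open>le\<close>, as \<open>?cd a\<close> is
      \<open>n - max_mult U\<close>.\<close>
    then have "2 * ?cd a \<le> n" "?cg c0 \<le> ?cd a" using sumU le b(2) c0(2) by auto
    then obtain A X e f where A: "diagonalized n A X e"
      "\<forall>c. card {i. i < n \<and> e i = c} = (if c = a then ?cd a else if c = b then n - ?cd a else 0)"
      "\<forall>c. card {i. i < n \<and> f i = c} = (if c = v 0 then ?cg c0 else if c = v 1 then ?cg c1 else if c = v 2 then ?cg c2 else 0)"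
      "generated_algebra n {A, mat_diag n f} = carrier_mat n n"
      using exists_generating_pair[of "?cg c1" "?cg c2" "?cg c0" "?cd a" n a b v]
        pos[of c1 g] pos[of c2 g] maxV(2)[of c1] maxV(2)[of c2] g c(2) c0(2) sumV a(2) unit
      by (auto simp: v_def inj_on_def)
    have "A \<in> unitary_orbit n U"
    proof (rule unitary_orbitI[OF U A(1)])
      fix c show "?cd c = card {i. i < n \<and> e i = c}"
        using A(2) sumU zero[of c d] a by auto
    qed
    moreover have "mat_diag n f \<in> unitary_orbit n V"
    proof (rule unitary_orbitI[OF V])
      show "diagonalized n (mat_diag n f) (1\<^sub>m n) f"
      proof -
        have "mat_adjoint (1\<^sub>m n :: complex mat) = 1\<^sub>m n" by (rule eq_matI) auto
        then show ?thesis
          using left_mult_one_mat[OF mat_diag_dim, of n f] right_mult_one_mat[OF mat_diag_dim, of n f]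
          by (simp add: diagonalized_def unitary_mat_def)
      qed
      fix c show "?cg c = card {i. i < n \<and> f i = c}"
        using A(3) zero[of c g] g by (auto simp: v_def)
    qed
    ultimately show "\<exists>U0 \<in> unitary_orbit n U. \<exists>V0 \<in> unitary_orbit n V.
            generated_algebra n {U0, V0} = carrier_mat n n"
      using A(4) by blast
  qed
qed

end
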